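(* For every $k\in\mathbb{Z}$, the quantum line bundle $L_{k}\equiv C(\mathbb{S}_{H}^{3})_{k}$ of degree $k$ over $C(\mathbb{P}^{1}(\mathcal{T}))$ is isomorphic, as a left $C(\mathbb{P}^{1}(\mathcal{T}))$-module, to the finitely generated projective left module over $C(\mathbb{P}^{1}(\mathcal{T}))$ determined by the projection $\tilde{I}-(P_{k}\oplus 0)$ if $k\geq 0$, and by the projection $\tilde{I}\boxplus(P_{-k}\oplus 0)$ if $k<0$.
   Context: $\mathbb{Z}_{\geq}$ is the set of nonnegative integers, $\overline{\mathbb{Z}}=\mathbb{Z}\cup\{\infty\}$ and $\overline{\mathbb{Z}_{\geq}}=\mathbb{Z}_{\geq}\cup\{\infty\}$ with the standard topology, $m+\infty=\infty$ for $m\in\mathbb{Z}$. $\mathcal{T}$ is the Toeplitz C*-algebra, generated by the unilateral shift $\mathcal{S}$ on $\ell^{2}(\mathbb{Z}_{\geq})$; $\mathcal{K}$ is the algebra of compact operators on $\ell^{2}(\mathbb{Z}_{\geq})$. The algebras: $C(\mathbb{S}_{H}^{3})=(\mathcal{T}\otimes\mathcal{T})/(\mathcal{K}\otimes\mathcal{K})$ is generated by the classes $w_{1},w_{2}$ of $\mathcal{S}\otimes 1$, $1\otimes\mathcal{S}$, with the $U(1)$-action $w_{i}\mapsto\zeta w_{i}$ ($\zeta\in U(1)$). It is identified with the groupoid C*-algebra $C^{*}(\mathcal{G})$, where $X=\overline{\mathbb{Z}_{\geq}}^{2}\setminus\mathbb{Z}_{\geq}^{2}=(\overline{\mathbb{Z}_{\geq}}\times\{\infty\})\cup(\{\infty\}\times\overline{\mathbb{Z}_{\geq}})$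 and $\mathcal{G}=(\mathbb{Z}^{2}\ltimes\overline{\mathbb{Z}}^{2})|_{X}=\{(m,l,p,q):(m,l)\in\mathbb{Z}^{2},\ (p,q)\in X,\ (p+m,q+l)\in X\}$; the element $(m,l,p,q)$ has source $(p,q)$ and range $(p+m,q+l)$, and $w_{1},w_{2}$ correspond to the characteristic functions of $\{(1,0,p,q)\in\mathcal{G}\}$ and $\{(0,1,p,q)\in\mathcal{G}\}$. For $k\in\mathbb{Z}$ put $\mathcal{G}_{k}=\{(m,l,p,q)\in\mathcal{G}:m+l=k\}$. Then $C(\mathbb{P}^{1}(\mathcal{T}))$, the $U(1)$-fixed point C*-subalgebra of $C(\mathbb{S}_{H}^{3})$, is $C^{*}(\mathcal{G}_{0})$, and the quantum line bundle of degree $k$ is the degree-$k$ spectral subspace $L_{k}=C(\mathbb{S}_{H}^{3})_{k}=\overline{C_{c}(\mathcal{G}_{k})}\subset C^{*}(\mathcal{G})$ (the elements on which $\zeta\in U(1)$ acts as multiplication by $\zeta^{k}$), a left $C(\mathbb{P}^{1}(\mathcal{T}))$-module under multiplication in $C(\mathbb{S}_{H}^{3})$. Let $U=(\mathbb{Z}_{\geq}\times\{\infty\})\sqcup(\{\infty\}\times\mathbb{Z}_{\geq})\subset X$. $C^{*}(\mathcal{G}_{0})$ is faithfully represented on $\ell^{2}(U)=\ell^{2}(\mathbb{Z}_{\geq})\oplus\ell^{2}(\mathbb{Z}_{\geq})$ (first summand for $\mathbb{Z}_{\geq}\times\{\infty\}$, second for $\{\infty\}\times\mathbb{Z}_{\geq}$)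 by $\pi(f)\delta_{(p,q)}=\sum_{n}f(n,-n,p,q)\,\delta_{(p+n,q-n)}$ for $f\in C_{c}(\mathcal{G}_{0})$; under $\pi$ the ideal $C^{*}(\mathcal{G}_{0}|_{U})$ is $\mathcal{K}\oplus\mathcal{K}$, so $\mathcal{K}\oplus\mathcal{K}\subset C(\mathbb{P}^{1}(\mathcal{T}))$. Notation: $\tilde{I}$ is the identity of $(\mathcal{K}\oplus\mathcal{K})^{+}\subset C(\mathbb{P}^{1}(\mathcal{T}))$ (unitization; it is the identity of $C(\mathbb{P}^{1}(\mathcal{T}))$). For an integer $m\geq 0$, $P_{m}\in\mathcal{K}$ is the projection onto the span of the first $m$ standard basis vectors of $\ell^{2}(\mathbb{Z}_{\geq})$, $P_{0}=0$, and $P_{m}\oplus 0\in\mathcal{K}\oplus\mathcal{K}$. $\boxplus$ is the block-diagonal sum of matrices. For a unital C*-algebra $\mathcal{A}$, the left module determined by a projection (self-adjoint idempotent) $P\in M_{n}(\mathcal{A})$ is $\mathcal{A}^{n}P$, with elements of $\mathcal{A}^{n}$ viewed as row vectors. *)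

theory Defs
  imports "HOL-Analysis.Analysis" "HOL-Library.Function_Algebras"
begin

typedef 'a ell2 = "{\<xi> :: 'a \<Rightarrow> complex. (\<lambda>x. (cmod (\<xi> x))\<^sup>2) summable_on UNIV}"
  morphisms coord Abs_ell2
  by (rule exI[of _ "\<lambda>_. 0"]) auto

setup_lifting type_definition_ell2

lemma coord_summable: "(\<lambda>x. (cmod (coord \<xi> x))\<^sup>2) summable_on UNIV"
  using coord[of \<xi>] by simp

lemma square_summable_mult:
  assumes "(\<lambda>x. (cmod (f x))\<^sup>2) summable_on A" "(\<lambda>x. (cmod (g x))\<^sup>2) summable_on A"
  shows "(\<lambda>x. norm (f x * g x)) summable_on A"
proof (rule Infinite_Sum.abs_summable_on_comparison_test)
  show "(\<lambda>x. norm ((cmod (f x))\<^sup>2 + (cmod (g x))\<^sup>2)) summable_on A"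
    using summable_on_add[OF assms] by simp
  show "norm (f x * g x) \<le> norm ((cmod (f x))\<^sup>2 + (cmod (g x))\<^sup>2)" for x
  proof -
    have "2 * (cmod (f x) * cmod (g x)) \<le> (cmod (f x))\<^sup>2 + (cmod (g x))\<^sup>2"
      using sum_squares_bound[of "cmod (f x)" "cmod (g x)"] by (simp add: mult.assoc)
    moreover have "0 \<le> cmod (f x) * cmod (g x)" by simp
    moreover have "norm ((cmod (f x))\<^sup>2 + (cmod (g x))\<^sup>2) = (cmod (f x))\<^sup>2 + (cmod (g x))\<^sup>2"
      by simp
    ultimately show ?thesis unfolding norm_mult by linarith
  qed
qed

lemma square_summable_add:
  assumes "(\<lambda>x. (cmod (f x))\<^sup>2) summable_on A" "(\<lambda>x. (cmod (g x))\<^sup>2) summable_on A"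
  shows "(\<lambda>x. (cmod (f x + g x))\<^sup>2) summable_on A"
proof (rule summable_on_comparison_test)
  show "(\<lambda>x. 2 * (cmod (f x))\<^sup>2 + 2 * (cmod (g x))\<^sup>2) summable_on A"
    by (intro summable_on_add summable_on_cmult_right assms)
  show "(cmod (f x + g x))\<^sup>2 \<le> 2 * (cmod (f x))\<^sup>2 + 2 * (cmod (g x))\<^sup>2" for x
  proof -
    have "(cmod (f x + g x))\<^sup>2 \<le> (cmod (f x) + cmod (g x))\<^sup>2"
      by (intro power_mono norm_triangle_ineq) auto
    also have "\<dots> \<le> 2 * (cmod (f x))\<^sup>2 + 2 * (cmod (g x))\<^sup>2"
      using sum_squares_bound[of "cmod (f x)" "cmod (g x)"] by (simp add: power2_sum)
    finally show ?thesis .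
  qed
qed auto

lemma square_summable_scale:
  assumes "(\<lambda>x. (cmod (f x))\<^sup>2) summable_on A"
  shows "(\<lambda>x. (cmod (c * f x))\<^sup>2) summable_on A"
  using summable_on_cmult_right[OF assms, of "(cmod c)\<^sup>2"]
  by (simp add: norm_mult power_mult_distrib)

lift_definition ell2_scale :: "complex \<Rightarrow> 'a ell2 \<Rightarrow> 'a ell2" is "\<lambda>c \<xi> x. c * \<xi> x"
  by (simp add: square_summable_scale)

definition ell2_cinner :: "'a ell2 \<Rightarrow> 'a ell2 \<Rightarrow> complex" where
  "ell2_cinner \<xi> \<eta> = (\<Sum>\<^sub>\<infinity>x. coord \<xi> x * cnj (coord \<eta> x))"

instantiation ell2 :: (type) real_vector
begin
lift_definition zero_ell2 :: "'a ell2" is "\<lambda>_. 0" by simp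
lift_definition plus_ell2 :: "'a ell2 \<Rightarrow> 'a ell2 \<Rightarrow> 'a ell2" is "\<lambda>\<xi> \<eta> x. \<xi> x + \<eta> x"
  by (simp add: square_summable_add)
lift_definition uminus_ell2 :: "'a ell2 \<Rightarrow> 'a ell2" is "\<lambda>\<xi> x. - \<xi> x" by simp
lift_definition minus_ell2 :: "'a ell2 \<Rightarrow> 'a ell2 \<Rightarrow> 'a ell2" is "\<lambda>\<xi> \<eta> x. \<xi> x - \<eta> x"
  subgoal for \<xi> \<eta> using square_summable_add[of \<xi> UNIV "\<lambda>x. - \<eta> x"] by simp
  done
lift_definition scaleR_ell2 :: "real \<Rightarrow> 'a ell2 \<Rightarrow> 'a ell2" is "\<lambda>r \<xi> x. r *\<^sub>R \<xi> x"
  subgoal for r \<xi> using square_summable_scale[of \<xi> UNIV "of_real r"]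
    by (simp add: scaleR_conv_of_real)
  done
instance
  by intro_classes (transfer; simp add: fun_eq_iff scaleR_add_right scaleR_add_left)+
end

text \<open>The real inner product is the real part of the complex one; it induces the usual norm, and
  for complex-linear operators real and complex boundedness and operator norms agree.\<close>

instantiation ell2 :: (type) real_inner
begin
definition inner_ell2 :: "'a ell2 \<Rightarrow> 'a ell2 \<Rightarrow> real" where
  "inner_ell2 \<xi> \<eta> = Re (ell2_cinner \<xi> \<eta>)"
definition norm_ell2 :: "'a ell2 \<Rightarrow> real" where
  "norm_ell2 \<xi> = sqrt (inner \<xi> \<xi>)"
definition sgn_ell2 :: "'a ell2 \<Rightarrow> 'a ell2" where
  "sgn_ell2 \<xi> = inverse (norm \<xi>) *\<^sub>R \<xi>"
definition dist_ell2 :: "'a ell2 \<Rightarrow> 'a ell2 \<Rightarrow> real" where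
  "dist_ell2 \<xi> \<eta> = norm (\<xi> - \<eta>)"
definition uniformity_ell2 :: "('a ell2 \<times> 'a ell2) filter" where
  "uniformity_ell2 = (INF e\<in>{0<..}. principal {(\<xi>, \<eta>). dist \<xi> \<eta> < e})"
definition open_ell2 :: "'a ell2 set \<Rightarrow> bool" where
  "open_ell2 S \<longleftrightarrow> (\<forall>\<xi>\<in>S. \<forall>\<^sub>F (\<xi>', \<eta>) in uniformity. \<xi>' = \<xi> \<longrightarrow> \<eta> \<in> S)"

lemma ell2_cinner_abs_summable:
  "(\<lambda>x. norm (coord \<xi> x * cnj (coord \<eta> x))) summable_on UNIV"
  by (rule square_summable_mult) (use coord_summable[of \<xi>] coord_summable[of \<eta>] in auto)

lemma ell2_cinner_summable: "(\<lambda>x. coord \<xi> x * cnj (coord \<eta> x)) summable_on UNIV"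
  by (rule abs_summable_summable[OF ell2_cinner_abs_summable])

lemma inner_ell2_eq: "inner \<xi> \<eta> = (\<Sum>\<^sub>\<infinity>x. Re (coord \<xi> x * cnj (coord \<eta> x)))"
  unfolding inner_ell2_def ell2_cinner_def by (rule infsum_Re[symmetric, OF ell2_cinner_summable])

lemma inner_ell2_self: "inner \<xi> \<xi> = (\<Sum>\<^sub>\<infinity>x. (cmod (coord \<xi> x))\<^sup>2)"
  unfolding inner_ell2_eq by (simp add: complex_mult_cnj cmod_power2)

instance
proof
  fix \<xi> \<eta> \<zeta> :: "'a ell2" and r :: real
  show "inner \<xi> \<eta> = inner \<eta> \<xi>"
    unfolding inner_ell2_eq by (rule infsum_cong) (simp add: mult.commute)
  have sm: "(\<lambda>x. Re (coord \<xi> x * cnj (coord \<eta> x))) summable_on UNIV" for \<xi> \<eta> :: "'a ell2"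
    by (rule summable_on_Re[OF ell2_cinner_summable])
  have "(\<Sum>\<^sub>\<infinity>x. Re (coord \<xi> x * cnj (coord \<zeta> x)) + Re (coord \<eta> x * cnj (coord \<zeta> x)))
      = inner \<xi> \<zeta> + inner \<eta> \<zeta>"
    unfolding inner_ell2_eq by (rule infsum_add[OF sm sm])
  then show "inner (\<xi> + \<eta>) \<zeta> = inner \<xi> \<zeta> + inner \<eta> \<zeta>"
    unfolding inner_ell2_eq[of "\<xi> + \<eta>"] by (simp add: plus_ell2.rep_eq algebra_simps)
  have "(\<Sum>\<^sub>\<infinity>x. r * Re (coord \<xi> x * cnj (coord \<eta> x))) = r * inner \<xi> \<eta>"
    unfolding inner_ell2_eq by (rule infsum_cmult_right[OF sm])
  then show "inner (r *\<^sub>R \<xi>) \<eta> = r * inner \<xi> \<eta>"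
    unfolding inner_ell2_eq[of "r *\<^sub>R \<xi>"] by (simp add: scaleR_ell2.rep_eq algebra_simps)
  show "0 \<le> inner \<xi> \<xi>"
    unfolding inner_ell2_self by (rule infsum_nonneg) simp
  show "inner \<xi> \<xi> = 0 \<longleftrightarrow> \<xi> = 0"
  proof
    assume "inner \<xi> \<xi> = 0"
    then have "(cmod (coord \<xi> x))\<^sup>2 = 0" for x
      using nonneg_infsum_le_0D[of "\<lambda>x. (cmod (coord \<xi> x))\<^sup>2" UNIV x]
      by (simp add: inner_ell2_self coord_summable)
    then show "\<xi> = 0"
      by (simp add: coord_inject[symmetric] zero_ell2.rep_eq fun_eq_iff)
  qed (simp add: inner_ell2_self zero_ell2.rep_eq)
qed (simp_all add: norm_ell2_def sgn_ell2_def dist_ell2_def uniformity_ell2_def open_ell2_def)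
end

text \<open>The bounded operator with matrix \<open>k y x = \<langle>T \<delta>\<^sub>x, \<delta>\<^sub>y\<rangle>\<close>.
  It is meaningful under the hypotheses of the Schur test, see \<open>coord_ell2_op\<close> below.\<close>

definition ell2_op :: "('b \<Rightarrow> 'a \<Rightarrow> complex) \<Rightarrow> ('a ell2 \<Rightarrow>\<^sub>L 'b ell2)" where
  "ell2_op k = Blinfun (\<lambda>\<xi>. Abs_ell2 (\<lambda>y. \<Sum>\<^sub>\<infinity>x. k y x * coord \<xi> x))"

lemma schur_row:
  fixes k :: "'b \<Rightarrow> 'a \<Rightarrow> complex"
  assumes C: "0 \<le> C" and row: "\<And>F. finite F \<Longrightarrow> (\<Sum>x\<in>F. cmod (k y x)) \<le> C"
  shows "(\<lambda>x. norm (k y x * coord \<xi> x)) summable_on UNIV"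
    and "(\<lambda>x. cmod (k y x) * (cmod (coord \<xi> x))\<^sup>2) summable_on UNIV"
    and "(cmod (\<Sum>\<^sub>\<infinity>x. k y x * coord \<xi> x))\<^sup>2
         \<le> C * (\<Sum>\<^sub>\<infinity>x. cmod (k y x) * (cmod (coord \<xi> x))\<^sup>2)"
proof -
  let ?w = "\<lambda>x. cmod (k y x) * (cmod (coord \<xi> x))\<^sup>2"
  let ?v = "\<lambda>x. cmod (k y x * coord \<xi> x)"
  have kC: "cmod (k y x) \<le> C" for x using row[of "{x}"] by simp
  show w: "?w summable_on UNIV"
  proof (rule summable_on_comparison_test)
    show "(\<lambda>x. C * (cmod (coord \<xi> x))\<^sup>2) summable_on UNIV"
      by (intro summable_on_cmult_right coord_summable)
  qed (auto intro: mult_right_mono kC)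
  let ?W = "infsum ?w UNIV"
  have W0: "0 \<le> ?W" by (rule infsum_nonneg) simp
  have fin: "sum ?v F \<le> sqrt (C * ?W)" if F: "finite F" for F
  proof -
    have "(sum ?v F)\<^sup>2 = (\<Sum>x\<in>F. sqrt (cmod (k y x)) * (sqrt (cmod (k y x)) * cmod (coord \<xi> x)))\<^sup>2"
      by (simp add: norm_mult mult.assoc[symmetric])
    also have "\<dots> \<le> (\<Sum>x\<in>F. (sqrt (cmod (k y x)))\<^sup>2)
        * (\<Sum>x\<in>F. (sqrt (cmod (k y x)) * cmod (coord \<xi> x))\<^sup>2)"
      by (rule Cauchy_Schwarz_ineq_sum)
    also have "\<dots> = (\<Sum>x\<in>F. cmod (k y x)) * sum ?w F"
      by (simp add: power_mult_distrib)
    also have "\<dots> \<le> C * ?W"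
      by (intro mult_mono row F C finite_sum_le_infsum w sum_nonneg) auto
    finally show ?thesis using real_le_rsqrt by blast
  qed
  show vs: "(\<lambda>x. norm (k y x * coord \<xi> x)) summable_on UNIV"
    by (rule nonneg_bounded_partial_sums_imp_summable_on[where C = "sqrt (C * ?W)"])
      (auto intro: fin)
  have "cmod (\<Sum>\<^sub>\<infinity>x. k y x * coord \<xi> x) \<le> infsum ?v UNIV"
    by (rule norm_infsum_bound[OF vs])
  also have "\<dots> \<le> sqrt (C * ?W)"
    by (rule infsum_le_finite_sums[OF vs]) (auto intro: fin)
  finally show "(cmod (\<Sum>\<^sub>\<infinity>x. k y x * coord \<xi> x))\<^sup>2 \<le> C * ?W"
    using C W0 by (metis norm_ge_zero power_mono real_sqrt_pow2 mult_nonneg_nonneg)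
qed

lemma schur_square_summable:
  fixes k :: "'b \<Rightarrow> 'a \<Rightarrow> complex"
  assumes C: "0 \<le> C"
    and row: "\<And>y F. finite F \<Longrightarrow> (\<Sum>x\<in>F. cmod (k y x)) \<le> C"
    and col: "\<And>x F. finite F \<Longrightarrow> (\<Sum>y\<in>F. cmod (k y x)) \<le> C"
  shows "(\<lambda>y. (cmod (\<Sum>\<^sub>\<infinity>x. k y x * coord \<xi> x))\<^sup>2) summable_on UNIV"
    and "(\<Sum>\<^sub>\<infinity>y. (cmod (\<Sum>\<^sub>\<infinity>x. k y x * coord \<xi> x))\<^sup>2) \<le> C\<^sup>2 * (norm \<xi>)\<^sup>2"
proof -
  let ?w = "\<lambda>y x. cmod (k y x) * (cmod (coord \<xi> x))\<^sup>2"
  let ?g = "\<lambda>y. (cmod (\<Sum>\<^sub>\<infinity>x. k y x * coord \<xi> x))\<^sup>2"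
  have ws: "?w y summable_on UNIV" for y by (rule schur_row[OF C row])
  have sums: "(\<Sum>y\<in>F. infsum (?w y) UNIV) = (\<Sum>\<^sub>\<infinity>x. \<Sum>y\<in>F. ?w y x)
      \<and> (\<lambda>x. \<Sum>y\<in>F. ?w y x) summable_on UNIV" if "finite F" for F
    using that by (induction F) (auto simp: infsum_add[OF ws] intro: summable_on_add ws)
  have n: "(norm \<xi>)\<^sup>2 = (\<Sum>\<^sub>\<infinity>x. (cmod (coord \<xi> x))\<^sup>2)"
    unfolding norm_ell2_def inner_ell2_self by (simp add: infsum_nonneg)
  have fin: "sum ?g F \<le> C\<^sup>2 * (norm \<xi>)\<^sup>2" if F: "finite F" for F
  proof -
    have "sum ?g F \<le> (\<Sum>y\<in>F. C * infsum (?w y) UNIV)"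
      by (intro sum_mono schur_row[OF C row])
    also have "\<dots> = C * (\<Sum>\<^sub>\<infinity>x. \<Sum>y\<in>F. ?w y x)"
      using sums[OF F] by (simp add: sum_distrib_left[symmetric])
    also have "\<dots> \<le> C * (\<Sum>\<^sub>\<infinity>x. C * (cmod (coord \<xi> x))\<^sup>2)"
    proof (intro mult_left_mono infsum_mono C)
      show "(\<lambda>x. \<Sum>y\<in>F. ?w y x) summable_on UNIV" using sums[OF F] by simp
      show "(\<lambda>x. C * (cmod (coord \<xi> x))\<^sup>2) summable_on UNIV"
        by (intro summable_on_cmult_right coord_summable)
      show "(\<Sum>y\<in>F. ?w y x) \<le> C * (cmod (coord \<xi> x))\<^sup>2" for x
        using col[OF F, of x] by (simp add: sum_distrib_right[symmetric] mult_right_mono)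
    qed
    also have "\<dots> = C\<^sup>2 * (norm \<xi>)\<^sup>2"
      unfolding infsum_cmult_right[OF coord_summable] n[symmetric] by (simp add: power2_eq_square)
    finally show ?thesis .
  qed
  show s: "?g summable_on UNIV"
    by (rule nonneg_bounded_partial_sums_imp_summable_on[where C = "C\<^sup>2 * (norm \<xi>)\<^sup>2"])
      (auto intro: fin)
  show "infsum ?g UNIV \<le> C\<^sup>2 * (norm \<xi>)\<^sup>2"
    by (rule infsum_le_finite_sums[OF s]) (auto intro: fin)
qed

lemma coord_ell2_op:
  fixes k :: "'b \<Rightarrow> 'a \<Rightarrow> complex"
  assumes C: "0 \<le> C"
    and row: "\<And>y F. finite F \<Longrightarrow> (\<Sum>x\<in>F. cmod (k y x)) \<le> C"
    and col: "\<And>x F. finite F \<Longrightarrow> (\<Sum>y\<in>F. cmod (k y x)) \<le> C"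
  shows "coord (blinfun_apply (ell2_op k) \<xi>) y = (\<Sum>\<^sub>\<infinity>x. k y x * coord \<xi> x)"
proof -
  let ?T = "\<lambda>\<xi>. Abs_ell2 (\<lambda>y. \<Sum>\<^sub>\<infinity>x. k y x * coord \<xi> x)"
  have cT: "coord (?T \<xi>) = (\<lambda>y. \<Sum>\<^sub>\<infinity>x. k y x * coord \<xi> x)" for \<xi>
    by (rule Abs_ell2_inverse) (simp add: schur_square_summable(1)[OF C row col])
  have s: "(\<lambda>x. k y x * coord \<xi> x) summable_on UNIV" for y \<xi>
    by (rule abs_summable_summable[OF schur_row(1)[OF C row]])
  have "bounded_linear ?T"
  proof (rule bounded_linear_intro[where K = C])
    fix \<xi> \<eta> :: "'a ell2" and r :: real
    show "?T (\<xi> + \<eta>) = ?T \<xi> + ?T \<eta>"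
      unfolding coord_inject[symmetric] cT unfolding plus_ell2.rep_eq cT
      by (simp add: distrib_left infsum_add[OF s s])
    have "(\<Sum>\<^sub>\<infinity>x. k y x * (r *\<^sub>R coord \<xi> x)) = r *\<^sub>R (\<Sum>\<^sub>\<infinity>x. k y x * coord \<xi> x)" for y
      using infsum_scaleR_right[of r "\<lambda>x. k y x * coord \<xi> x" UNIV] by simp
    then show "?T (r *\<^sub>R \<xi>) = r *\<^sub>R ?T \<xi>"
      unfolding coord_inject[symmetric] cT unfolding scaleR_ell2.rep_eq cT by simp
    have "(norm (?T \<xi>))\<^sup>2 = (\<Sum>\<^sub>\<infinity>y. (cmod (coord (?T \<xi>) y))\<^sup>2)"
      unfolding norm_ell2_def inner_ell2_self by (simp add: infsum_nonneg)
    also have "\<dots> \<le> C\<^sup>2 * (norm \<xi>)\<^sup>2"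
      unfolding cT by (rule schur_square_summable(2)[OF C row col])
    finally have "(norm (?T \<xi>))\<^sup>2 \<le> (norm \<xi> * C)\<^sup>2"
      by (simp only: power_mult_distrib mult.commute)
    then show "norm (?T \<xi>) \<le> norm \<xi> * C"
      by (rule power2_le_imp_le) (simp add: C)
  qed
  then show ?thesis
    unfolding ell2_op_def by (simp add: bounded_linear_Blinfun_apply cT)
qed

text \<open>\<open>\<int> \<union> {\<infinity>}\<close> is realised inside \<^typ>\<open>ereal\<close>: addition and the subspace topology are the
  intended ones. The pair \<open>((m, l), (p, q))\<close> is written as a quadruple.\<close>

type_synonym arrow = "int \<times> int \<times> ereal \<times> ereal"

definition Zge_bar :: "ereal set" where
  "Zge_bar = range (\<lambda>n::nat. ereal (real n)) \<union> {\<infinity>}"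

definition unit_space :: "(ereal \<times> ereal) set" where
  "unit_space = Zge_bar \<times> {\<infinity>} \<union> {\<infinity>} \<times> Zge_bar"

fun src :: "arrow \<Rightarrow> ereal \<times> ereal" where
  "src (m, l, p, q) = (p, q)"

fun rng :: "arrow \<Rightarrow> ereal \<times> ereal" where
  "rng (m, l, p, q) = (p + ereal (of_int m), q + ereal (of_int l))"

fun ginv :: "arrow \<Rightarrow> arrow" where
  "ginv (m, l, p, q) = (- m, - l, p + ereal (of_int m), q + ereal (of_int l))"

text \<open>The product of \<open>\<alpha>\<close> and \<open>\<beta>\<close>, to be used only when \<open>src \<alpha> = rng \<beta>\<close>.\<close>

fun gmul :: "arrow \<Rightarrow> arrow \<Rightarrow> arrow" where
  "gmul (m, l, _, _) (m', l', p, q) = (m + m', l + l', p, q)"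

fun deg :: "arrow \<Rightarrow> int" where
  "deg (m, l, p, q) = m + l"

definition gpd :: "arrow set" where
  "gpd = {\<gamma>. src \<gamma> \<in> unit_space \<and> rng \<gamma> \<in> unit_space}"

definition gpd_deg :: "int \<Rightarrow> arrow set" where
  "gpd_deg k = {\<gamma> \<in> gpd. deg \<gamma> = k}"

text \<open>Functions on \<open>S\<close> are extended by zero. Since \<open>gpd_deg k\<close> is clopen in \<open>gpd\<close>, this makes
  \<open>Cc (gpd_deg k)\<close> a subspace of \<open>Cc gpd\<close>.\<close>

definition Cc :: "arrow set \<Rightarrow> (arrow \<Rightarrow> complex) set" where
  "Cc S = {f. continuous_on S f \<and> (\<exists>K. compact K \<and> K \<subseteq> S \<and> (\<forall>\<gamma>. \<gamma> \<notin> K \<longrightarrow> f \<gamma> = 0))}"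

text \<open>The left regular representation, that is convolution
  \<open>(f * \<xi>)(\<gamma>) = \<Sum>\<^sub>\<beta> f(\<gamma> \<beta>\<inverse>) \<xi>(\<beta>)\<close> over all \<open>\<beta>\<close> with the source of \<open>\<gamma>\<close>. The Hilbert space
  \<open>\<ell>\<^sup>2(gpd)\<close> is regarded as the subspace of \<open>arrow ell2\<close> of families supported in \<open>gpd\<close>; operators
  on it are extended by zero on the orthogonal complement, which changes neither norms nor
  products. As the groupoid is amenable, the closure of the image is its C*-algebra (full and
  reduced). In particular the identity of this algebra is the projection onto \<open>\<ell>\<^sup>2(gpd)\<close>, not
  \<^const>\<open>id_blinfun\<close>.\<close>

type_synonym gop = "arrow ell2 \<Rightarrow>\<^sub>L arrow ell2"

definition reg_rep :: "(arrow \<Rightarrow> complex) \<Rightarrow> gop" where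
  "reg_rep f = ell2_op (\<lambda>\<gamma> \<beta>. if \<gamma> \<in> gpd \<and> \<beta> \<in> gpd \<and> src \<gamma> = src \<beta>
     then f (gmul \<gamma> (ginv \<beta>)) else 0)"

lemma sum_le_card_times:
  fixes h :: "'a \<Rightarrow> real"
  assumes F: "finite F" and D: "finite D" and B: "\<And>x. h x \<le> B" "0 \<le> B"
    and inj: "inj_on g {x\<in>F. h x \<noteq> 0}" and im: "g ` {x\<in>F. h x \<noteq> 0} \<subseteq> D"
  shows "sum h F \<le> real (card D) * B"
proof -
  have "sum h F = sum h {x\<in>F. h x \<noteq> 0}"
    using F by (intro sum.mono_neutral_right) auto
  also have "\<dots> \<le> real (card {x\<in>F. h x \<noteq> 0}) * B"
    by (rule sum_bounded_above) (rule B)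
  also have "\<dots> \<le> real (card D) * B"
    using card_inj_on_le[OF inj im D] B(2) by (intro mult_right_mono) auto
  finally show ?thesis .
qed

lemma Cc_bounded_finite:
  assumes "f \<in> Cc S"
  obtains D B where "finite D" "0 \<le> B" "\<And>\<gamma>. cmod (f \<gamma>) \<le> B"
    "\<And>m l p q. f (m, l, p, q) \<noteq> 0 \<Longrightarrow> (m, l) \<in> D"
proof -
  obtain K where K: "compact K" "K \<subseteq> S" "\<And>\<gamma>. \<gamma> \<notin> K \<Longrightarrow> f \<gamma> = 0" and f: "continuous_on S f"
    using assms by (auto simp: Cc_def)
  have "compact (f ` K)"
    using compact_continuous_image continuous_on_subset f K by blast
  then obtain B where B: "\<And>x. x \<in> K \<Longrightarrow> cmod (f x) \<le> B"
    by (meson bounded_iff compact_imp_bounded imageI)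
  have fin: "finite A" if "compact A" for A :: "int set"
  proof -
    from that have "finite (A \<inter> \<Union>((\<lambda>x. {x}) ` A))"
      by (auto dest: compactE_image[where C = A and f = "\<lambda>x. {x}" and S = A]
          simp: open_discrete intro: finite_subset)
    then show ?thesis by (simp add: UN_singleton)
  qed
  have "finite (fst ` K)" "finite ((fst \<circ> snd) ` K)"
    by (intro fin compact_continuous_image continuous_intros K continuous_on_subset[OF _ subset_UNIV];
        simp add: o_def continuous_on_fst continuous_on_snd)+
  then have "finite (fst ` K \<times> (fst \<circ> snd) ` K)" by simp
  then show ?thesis
  proof (rule that[of _ "max B 0"])
    show "cmod (f \<gamma>) \<le> max B 0" for \<gamma>
      using B[of \<gamma>] K(3)[of \<gamma>] by (cases "\<gamma> \<in> K") auto
    show "(m, l) \<in> fst ` K \<times> (fst \<circ> snd) ` K" if "f (m, l, p, q) \<noteq> 0" for m l p q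
      using K(3)[of "(m,l,p,q)"] that by (force simp: image_iff)
  qed auto
qed

lemma coord_reg_rep:
  assumes f: "f \<in> Cc gpd"
  shows "coord (blinfun_apply (reg_rep f) \<xi>) \<gamma> =
    (\<Sum>\<^sub>\<infinity>\<beta>. (if \<gamma> \<in> gpd \<and> \<beta> \<in> gpd \<and> src \<gamma> = src \<beta> then f (gmul \<gamma> (ginv \<beta>)) else 0) * coord \<xi> \<beta>)"
proof -
  obtain D B where D: "finite D" "0 \<le> B" "\<And>\<gamma>. cmod (f \<gamma>) \<le> B"
    "\<And>m l p q. f (m, l, p, q) \<noteq> 0 \<Longrightarrow> (m, l) \<in> D"
    using Cc_bounded_finite[OF f] by metis
  define g where "g = (\<lambda>(\<gamma>::arrow) (\<beta>::arrow). (fst \<gamma> - fst \<beta>, fst (snd \<gamma>) - fst (snd \<beta>)))"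
  have im: "g \<gamma> \<beta> \<in> D" if "f (gmul \<gamma> (ginv \<beta>)) \<noteq> 0" for \<gamma> \<beta>
    using that D(4) by (cases \<gamma>; cases \<beta>) (auto simp: g_def)
  show ?thesis
    unfolding reg_rep_def
  proof (rule coord_ell2_op[where C = "real (card D) * B"])
    show "(\<Sum>\<beta>\<in>F. cmod (if \<gamma> \<in> gpd \<and> \<beta> \<in> gpd \<and> src \<gamma> = src \<beta> then f (gmul \<gamma> (ginv \<beta>)) else 0))
        \<le> real (card D) * B" if "finite F" for \<gamma> F
      by (rule sum_le_card_times[where g = "g \<gamma>"])
        (use that D in \<open>auto simp: inj_on_def im split: if_splits, auto simp: g_def\<close>)
    show "(\<Sum>\<gamma>\<in>F. cmod (if \<gamma> \<in> gpd \<and> \<beta> \<in> gpd \<and> src \<gamma> = src \<beta> then f (gmul \<gamma> (ginv \<beta>)) else 0))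
        \<le> real (card D) * B" if "finite F" for \<beta> F
      by (rule sum_le_card_times[where g = "\<lambda>\<gamma>. g \<gamma> \<beta>"])
        (use that D in \<open>auto simp: inj_on_def im split: if_splits, auto simp: g_def, (metis prod.inject)+\<close>)
  qed (use D in auto)
qed

definition C_S3H :: "gop set" where
  "C_S3H = closure (reg_rep ` Cc gpd)"

text \<open>The action of \<open>U(1)\<close> is implemented by the diagonal unitaries \<open>\<delta>\<^sub>\<gamma> \<mapsto> \<zeta>\<^bsup>deg \<gamma>\<^esup> \<delta>\<^sub>\<gamma>\<close>; it maps
  \<open>reg_rep f\<close> to \<open>reg_rep (\<lambda>\<gamma>. \<zeta>\<^bsup>deg \<gamma>\<^esup> f \<gamma>)\<close>, in particular \<open>w\<^sub>i\<close> to \<open>\<zeta> w\<^sub>i\<close> for the characteristic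
  functions \<open>w\<^sub>1\<close>, \<open>w\<^sub>2\<close> of the arrows \<open>(1, 0, p, q)\<close> and \<open>(0, 1, p, q)\<close>.\<close>

definition gauge :: "complex \<Rightarrow> gop" where
  "gauge \<zeta> = ell2_op (\<lambda>\<gamma> \<beta>. if \<gamma> = \<beta> then \<zeta> powi deg \<gamma> else 0)"

definition gauge_action :: "complex \<Rightarrow> gop \<Rightarrow> gop" where
  "gauge_action \<zeta> a = gauge \<zeta> o\<^sub>L a o\<^sub>L gauge (cnj \<zeta>)"

definition C_P1T :: "gop set" where
  "C_P1T = {a \<in> C_S3H. \<forall>\<zeta>. cmod \<zeta> = 1 \<longrightarrow> gauge_action \<zeta> a = a}"

definition line_bundle :: "int \<Rightarrow> gop set" where
  "line_bundle k = {a \<in> C_S3H. \<forall>\<zeta>. cmod \<zeta> = 1 \<longrightarrow>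
     (\<forall>\<xi>. blinfun_apply (gauge_action \<zeta> a) \<xi> = ell2_scale (\<zeta> powi k) (blinfun_apply a \<xi>))}"

text \<open>\<open>\<ell>\<^sup>2(U)\<close> is \<open>(nat + nat) ell2\<close>, the basis vector of \<open>i\<close> being that of \<open>U_point i\<close>.\<close>

fun U_point :: "nat + nat \<Rightarrow> ereal \<times> ereal" where
  "U_point (Inl p) = (ereal (real p), \<infinity>)"
| "U_point (Inr q) = (\<infinity>, ereal (real q))"

type_synonym uop = "(nat + nat) ell2 \<Rightarrow>\<^sub>L (nat + nat) ell2"

text \<open>On \<open>Cc (gpd_deg 0)\<close>: the coefficient at \<open>i\<close> of the image of the basis vector \<open>j\<close> collects the
  terms \<open>f (n, -n, p, q)\<close>, \<open>(p, q) = U_point j\<close>, with \<open>(p + n, q - n) = U_point i\<close>.\<close>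

definition pi_rep :: "(arrow \<Rightarrow> complex) \<Rightarrow> uop" where
  "pi_rep f = ell2_op (\<lambda>i j. case U_point j of (p, q) \<Rightarrow>
     (\<Sum>n | (p + ereal (of_int n), q - ereal (of_int n)) = U_point i. f (n, - n, p, q)))"

lemma coord_pi_rep:
  assumes f: "f \<in> Cc gpd"
  shows "coord (blinfun_apply (pi_rep f) \<xi>) i =
    (\<Sum>\<^sub>\<infinity>j. (case U_point j of (p, q) \<Rightarrow>
     (\<Sum>n | (p + ereal (of_int n), q - ereal (of_int n)) = U_point i. f (n, - n, p, q))) * coord \<xi> j)"
proof -
  obtain D B where D: "finite D" "0 \<le> B" "\<And>\<gamma>. cmod (f \<gamma>) \<le> B"
    "\<And>m l p q. f (m, l, p, q) \<noteq> 0 \<Longrightarrow> (m, l) \<in> D"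
    using Cc_bounded_finite[OF f] by metis
  define d :: "nat + nat \<Rightarrow> nat + nat \<Rightarrow> int" where
    "d i j = (case (i, j) of (Inl a, Inl b) \<Rightarrow> int a - int b | (Inr a, Inr b) \<Rightarrow> int b - int a | _ \<Rightarrow> 0)"
    for i j
  let ?k = "\<lambda>i j. case U_point j of (p, q) \<Rightarrow>
     (\<Sum>n | (p + ereal (of_int n), q - ereal (of_int n)) = U_point i. f (n, - n, p, q))"
  have set: "{n. (ereal (real b) + ereal (of_int n), \<infinity> - ereal (of_int n)) = (ereal (real a), \<infinity>)} = {int a - int b}"
    "{n. (\<infinity> + ereal (of_int n), ereal (real b) - ereal (of_int n)) = (\<infinity>, ereal (real a))} = {int b - int a}" for a b
    by (auto; linarith)+
  have k: "?k i j = (case (i, j) of (Inl a, Inl b) \<Rightarrow> f (d i j, - d i j, U_point j)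
      | (Inr a, Inr b) \<Rightarrow> f (d i j, - d i j, U_point j) | _ \<Rightarrow> 0)" for i j
    using set by (cases i; cases j) (simp_all add: d_def)
  show ?thesis
    unfolding pi_rep_def
  proof (rule coord_ell2_op[where C = "real (card ((\<lambda>(m,l). (m,True)) ` D \<union> (\<lambda>(m,l). (m,False)) ` D)) * B"])
    have b: "cmod (?k i j) \<le> B" for i j
      unfolding k using D by (auto split: sum.splits)
    have im: "?k i j \<noteq> 0 \<Longrightarrow> (d i j, - d i j) \<in> D \<and> isl i = isl j" for i j
      unfolding k using D(4) by (auto split: sum.splits)
    have inj: "d i j = d i j' \<Longrightarrow> isl i = isl j \<Longrightarrow> isl i = isl j' \<Longrightarrow> j = j'"
        "d i j = d i' j \<Longrightarrow> isl i = isl j \<Longrightarrow> isl i' = isl j \<Longrightarrow> i = i'" for i j i' j'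
      unfolding d_def by (auto split: sum.splits)
    have im': "?k i j \<noteq> 0 \<Longrightarrow> (d i j, isl j) \<in> (\<lambda>(m,l). (m,True)) ` D \<union> (\<lambda>(m,l). (m,False)) ` D" for i j
      using im[of i j] by (cases "isl j") force+
    show "(\<Sum>j\<in>F. cmod (?k i j)) \<le> real (card ((\<lambda>(m,l). (m,True)) ` D \<union> (\<lambda>(m,l). (m,False)) ` D)) * B" if "finite F" for i F
    proof (rule sum_le_card_times[where g = "\<lambda>j. (d i j, isl j)", OF that _ b D(2)])
      show "inj_on (\<lambda>j. (d i j, isl j)) {j \<in> F. cmod (?k i j) \<noteq> 0}"
        using im[of i] inj(1)[of i] unfolding inj_on_def norm_eq_zero by blast
      show "(\<lambda>j. (d i j, isl j)) ` {j \<in> F. cmod (?k i j) \<noteq> 0} \<subseteq> (\<lambda>(m,l). (m,True)) ` D \<union> (\<lambda>(m,l). (m,False)) ` D"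
        using im'[of i] unfolding norm_eq_zero by blast
    qed (use D in simp)
    show "(\<Sum>i\<in>F. cmod (?k i j)) \<le> real (card ((\<lambda>(m,l). (m,True)) ` D \<union> (\<lambda>(m,l). (m,False)) ` D)) * B" if "finite F" for j F
    proof (rule sum_le_card_times[where g = "\<lambda>i. (d i j, isl j)", OF that _ b D(2)])
      show "inj_on (\<lambda>i. (d i j, isl j)) {i \<in> F. cmod (?k i j) \<noteq> 0}"
        using im inj(2)[of _ j] unfolding inj_on_def norm_eq_zero by blast
      show "(\<lambda>i. (d i j, isl j)) ` {i \<in> F. cmod (?k i j) \<noteq> 0} \<subseteq> (\<lambda>(m,l). (m,True)) ` D \<union> (\<lambda>(m,l). (m,False)) ` D"
        using im' unfolding norm_eq_zero by blast
    qed (use D in simp)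
  qed (use D in auto)
qed

text \<open>The graph of the continuous extension of \<^const>\<open>pi_rep\<close> to the C*-algebra of \<open>gpd_deg 0\<close>.\<close>

definition pi_ext :: "gop \<Rightarrow> uop \<Rightarrow> bool" where
  "pi_ext a T \<longleftrightarrow> (\<exists>f. (\<forall>n. f n \<in> Cc (gpd_deg 0)) \<and>
     (\<lambda>n. reg_rep (f n)) \<longlonglongrightarrow> a \<and> (\<lambda>n. pi_rep (f n)) \<longlonglongrightarrow> T)"

text \<open>The inclusion of \<open>K \<oplus> K\<close>, that is the inverse of the representation there.\<close>

definition KK_embed :: "uop \<Rightarrow> gop" where
  "KK_embed T = (THE a. a \<in> C_P1T \<and> pi_ext a T)"

definition incl_left :: "nat ell2 \<Rightarrow>\<^sub>L (nat + nat) ell2" where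
  "incl_left = ell2_op (\<lambda>i j. if i = Inl j then 1 else 0)"

definition incl_right :: "nat ell2 \<Rightarrow>\<^sub>L (nat + nat) ell2" where
  "incl_right = ell2_op (\<lambda>i j. if i = Inr j then 1 else 0)"

definition proj_left :: "(nat + nat) ell2 \<Rightarrow>\<^sub>L nat ell2" where
  "proj_left = ell2_op (\<lambda>i j. if j = Inl i then 1 else 0)"

definition proj_right :: "(nat + nat) ell2 \<Rightarrow>\<^sub>L nat ell2" where
  "proj_right = ell2_op (\<lambda>i j. if j = Inr i then 1 else 0)"

definition op_dsum :: "(nat ell2 \<Rightarrow>\<^sub>L nat ell2) \<Rightarrow> (nat ell2 \<Rightarrow>\<^sub>L nat ell2) \<Rightarrow> uop" where
  "op_dsum S T = (incl_left o\<^sub>L S o\<^sub>L proj_left) + (incl_right o\<^sub>L T o\<^sub>L proj_right)"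

definition fin_proj :: "nat \<Rightarrow> (nat ell2 \<Rightarrow>\<^sub>L nat ell2)" where
  "fin_proj m = ell2_op (\<lambda>i j. if i = j \<and> i < m then 1 else 0)"

definition P_oplus_0 :: "nat \<Rightarrow> gop" where
  "P_oplus_0 m = KK_embed (op_dsum (fin_proj m) 0)"

definition I_tilde :: gop where
  "I_tilde = (THE e. e \<in> C_P1T \<and> (\<forall>a\<in>C_P1T. e o\<^sub>L a = a \<and> a o\<^sub>L e = a))"

text \<open>Row vectors and square matrices of size \<open>n\<close> are functions of indices below \<open>n\<close>, with zero
  entries elsewhere; the size is always passed explicitly.\<close>

definition ell2_adjoint :: "('a ell2 \<Rightarrow>\<^sub>L 'b ell2) \<Rightarrow> ('b ell2 \<Rightarrow>\<^sub>L 'a ell2) \<Rightarrow> bool" where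
  "ell2_adjoint S T \<longleftrightarrow>
     (\<forall>\<xi> \<eta>. ell2_cinner (blinfun_apply S \<xi>) \<eta> = ell2_cinner \<xi> (blinfun_apply T \<eta>))"

definition matrices :: "gop set \<Rightarrow> nat \<Rightarrow> (nat \<Rightarrow> nat \<Rightarrow> gop) set" where
  "matrices A n = {P. (\<forall>i<n. \<forall>j<n. P i j \<in> A) \<and> (\<forall>i j. i \<ge> n \<or> j \<ge> n \<longrightarrow> P i j = 0)}"

definition projections :: "gop set \<Rightarrow> nat \<Rightarrow> (nat \<Rightarrow> nat \<Rightarrow> gop) set" where
  "projections A n = {P \<in> matrices A n.
     (\<forall>i<n. \<forall>j<n. ell2_adjoint (P i j) (P j i)) \<and>
     (\<forall>i<n. \<forall>j<n. (\<Sum>l<n. P i l o\<^sub>L P l j) = P i j)}"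

definition row_vectors :: "gop set \<Rightarrow> nat \<Rightarrow> (nat \<Rightarrow> gop) set" where
  "row_vectors A n = {v. (\<forall>i<n. v i \<in> A) \<and> (\<forall>i\<ge>n. v i = 0)}"

definition row_mult :: "nat \<Rightarrow> (nat \<Rightarrow> gop) \<Rightarrow> (nat \<Rightarrow> nat \<Rightarrow> gop) \<Rightarrow> (nat \<Rightarrow> gop)" where
  "row_mult n v P = (\<lambda>j. if j < n then \<Sum>i<n. v i o\<^sub>L P i j else 0)"

definition proj_module :: "gop set \<Rightarrow> nat \<Rightarrow> (nat \<Rightarrow> nat \<Rightarrow> gop) \<Rightarrow> (nat \<Rightarrow> gop) set" where
  "proj_module A n P = (\<lambda>v. row_mult n v P) ` row_vectors A n"

definition row_act :: "gop \<Rightarrow> (nat \<Rightarrow> gop) \<Rightarrow> (nat \<Rightarrow> gop)" where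
  "row_act a v = (\<lambda>i. a o\<^sub>L v i)"

definition mat1 :: "gop \<Rightarrow> nat \<Rightarrow> nat \<Rightarrow> gop" where
  "mat1 a = (\<lambda>i j. if i = 0 \<and> j = 0 then a else 0)"

text \<open>Here \<open>n\<close> is the size of the first block \<open>P\<close>.\<close>

definition block_diag ::
  "nat \<Rightarrow> (nat \<Rightarrow> nat \<Rightarrow> gop) \<Rightarrow> (nat \<Rightarrow> nat \<Rightarrow> gop) \<Rightarrow> (nat \<Rightarrow> nat \<Rightarrow> gop)" where
  "block_diag n P Q = (\<lambda>i j. if i < n \<and> j < n then P i j
     else if i \<ge> n \<and> j \<ge> n then Q (i - n) (j - n) else 0)"

definition left_module ::
  "gop set \<Rightarrow> gop \<Rightarrow> 'm::ab_group_add set \<Rightarrow> (gop \<Rightarrow> 'm \<Rightarrow> 'm) \<Rightarrow> bool" where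
  "left_module A e M act \<longleftrightarrow>
     0 \<in> M \<and> (\<forall>x\<in>M. \<forall>y\<in>M. x + y \<in> M) \<and> (\<forall>x\<in>M. - x \<in> M) \<and>
     (\<forall>a\<in>A. \<forall>x\<in>M. act a x \<in> M) \<and> (\<forall>x\<in>M. act e x = x) \<and>
     (\<forall>a\<in>A. \<forall>b\<in>A. \<forall>x\<in>M. act (a o\<^sub>L b) x = act a (act b x) \<and>
        act (a + b) x = act a x + act b x) \<and>
     (\<forall>a\<in>A. \<forall>x\<in>M. \<forall>y\<in>M. act a (x + y) = act a x + act a y)"

definition left_module_isomorphic ::
  "gop set \<Rightarrow> gop \<Rightarrow> 'm::ab_group_add set \<Rightarrow> (gop \<Rightarrow> 'm \<Rightarrow> 'm) \<Rightarrow>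
   'n::ab_group_add set \<Rightarrow> (gop \<Rightarrow> 'n \<Rightarrow> 'n) \<Rightarrow> bool" where
  "left_module_isomorphic A e M actM N actN \<longleftrightarrow>
     left_module A e M actM \<and> left_module A e N actN \<and>
     (\<exists>\<phi>. bij_betw \<phi> M N \<and> (\<forall>x\<in>M. \<forall>y\<in>M. \<phi> (x + y) = \<phi> x + \<phi> y) \<and>
        (\<forall>a\<in>A. \<forall>x\<in>M. \<phi> (actM a x) = actN a (\<phi> x)))"

end

theory Submission
  imports Defs
begin

text \<open>Each bundle \<open>L\<^sub>k\<close> has a finite frame: elements \<open>v\<^sub>i\<close> of degree \<open>k\<close> and \<open>w\<^sub>i\<close> of degree \<open>- k\<close>
with \<open>\<Sum>\<^sub>i w\<^sub>i v\<^sub>i = 1\<close>. Then \<open>P\<^sub>i\<^sub>j = v\<^sub>i w\<^sub>j\<close> has degree \<open>0\<close> and is an idempotent matrix, and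
\<open>x \<mapsto> (x w\<^sub>j)\<^sub>j\<close> identifies \<open>L\<^sub>k\<close> with the module of rows \<open>y\<close> such that \<open>y = y P\<close>; the inverse is
\<open>y \<mapsto> \<Sum>\<^sub>i y\<^sub>i v\<^sub>i\<close> (\<open>frame_isomorphism\<close>). Hence it suffices to produce frames with the required
products.

For \<open>k = n \<ge> 0\<close> the single element \<open>v = s\<^sup>n\<close>, where \<open>s\<close> is the generator that shifts the first
coordinate, is an isometry: \<open>v* v = 1\<close>, while \<open>v v*\<close> is the projection onto the arrows with range
outside the corner \<open>{(p, \<infinity>). p < n}\<close>, which is \<open>1 - (P\<^sub>n \<oplus> 0)\<close> (\<open>isometry_frame\<close>). For
\<open>k = - n < 0\<close> the element \<open>v*\<close> alone does not suffice, because \<open>v v*\<close> misses the corner. The second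
coordinate repairs this: on the corner translation of the second coordinate fixes every point, as
\<open>\<infinity> - n = \<infinity>\<close>, but changes the degree. So \<open>u\<close>, the translation \<open>(0, - n)\<close> restricted to the
corner, is a partial isometry of degree \<open>- n\<close> with \<open>u* u = u u* = P\<^sub>n \<oplus> 0\<close>, and its initial space
is orthogonal to that of \<open>v*\<close> (\<open>corner_frame\<close>); the frame \<open>(v*, u)\<close> gives the block diagonal
projection \<open>1 \<boxplus> (P\<^sub>n \<oplus> 0)\<close>.

All these elements are weighted translations, the images of functions on the groupoid supported on
a single degree \<open>(m, l)\<close>. Their products are explicit (\<open>wshift_compose\<close>), and they span the image of
the regular representation, so that this image is an algebra and algebraic identities in its
closure can be checked on them alone (\<open>C_S3H_closed_property\<close>). The remaining point is that
\<open>P\<^sub>n \<oplus> 0\<close>, given by an operator on \<open>\<ell>\<^sup>2(U)\<close>, has only one preimage in the C*-algebra. This is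
\<open>pi_ext_faithful\<close>: since \<open>U\<close> is dense in the unit space, the norm on \<open>\<ell>\<^sup>2(U)\<close> dominates the
supremum norm of functions of degree \<open>0\<close>, and the latter controls every matrix coefficient in the
regular representation.\<close>

section \<open>Partial translations of the unit space\<close>

definition shift :: "int \<Rightarrow> int \<Rightarrow> ereal \<times> ereal \<Rightarrow> ereal \<times> ereal" where
  "shift m l x = (fst x + ereal (of_int m), snd x + ereal (of_int l))"

text \<open>The slice of the groupoid at \<open>(m, l)\<close>, seen inside the unit space: the domain of the partial
  translation by \<open>(m, l)\<close>.\<close>

definition shift_dom :: "int \<Rightarrow> int \<Rightarrow> (ereal \<times> ereal) set" where
  "shift_dom m l = {x \<in> unit_space. shift m l x \<in> unit_space}"

lemma shift_shift: "shift m l (shift m' l' x) = shift (m + m') (l + l') x"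
  by (simp add: shift_def add.assoc add.commute[of "real_of_int m"] add.commute[of "real_of_int l"])

lemma shift_0 [simp]: "shift 0 0 x = x"
  by (simp add: shift_def flip: zero_ereal_def)

lemma shift_dom_0 [simp]: "shift_dom 0 0 = unit_space"
  by (simp add: shift_dom_def)

text \<open>A quadruple is read as a triple \<open>(m, l, x)\<close> whose last entry \<open>x\<close> is the source.\<close>

lemma arrow_simps [simp]:
  "src (m, l, x) = x" "rng (m, l, x) = shift m l x"
  "ginv (m, l, x) = (- m, - l, shift m l x)" "deg (m, l, x) = m + l"
  "gmul (m, l, y) (m', l', x) = (m + m', l + l', x)"
  by (cases x; cases y; simp add: shift_def)+

lemma mem_gpd: "(m, l, x) \<in> gpd \<longleftrightarrow> x \<in> shift_dom m l"
  by (simp add: gpd_def shift_dom_def)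

lemma unit_space_cases:
  assumes "x \<in> unit_space"
  obtains n :: nat where "x = (ereal (real n), \<infinity>)" | n :: nat where "x = (\<infinity>, ereal (real n))"
    | "x = (\<infinity>, \<infinity>)"
  using assms by (auto simp: unit_space_def Zge_bar_def)

lemma int_mem_Zge_bar: "ereal (of_int i) \<in> Zge_bar \<longleftrightarrow> 0 \<le> i"
proof
  assume "0 \<le> i"
  then have "ereal (of_int i) = ereal (real (nat i))" by simp
  then show "ereal (of_int i) \<in> Zge_bar" unfolding Zge_bar_def by blast
next
  assume "ereal (of_int i) \<in> Zge_bar"
  then obtain n where "real_of_int i = real n" by (auto simp: Zge_bar_def)
  then show "0 \<le> i" by linarith
qed

lemma infinity_mem_Zge_bar [simp]: "\<infinity> \<in> Zge_bar" and nat_mem_Zge_bar [simp]: "ereal (real n) \<in> Zge_bar"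
  by (auto simp: Zge_bar_def)

lemma nat_plus_int_mem_Zge_bar: "ereal (real n) + ereal (of_int m) \<in> Zge_bar \<longleftrightarrow> 0 \<le> int n + m"
  using int_mem_Zge_bar[of "int n + m"] by simp

lemma nat_plus_int_mem_Zge_bar': "ereal (real n + of_int m) \<in> Zge_bar \<longleftrightarrow> 0 \<le> int n + m"
  using int_mem_Zge_bar[of "int n + m"] by simp

lemma shift_dom_simps [simp]:
  "(ereal (real n), \<infinity>) \<in> shift_dom m l \<longleftrightarrow> 0 \<le> int n + m"
  "(\<infinity>, ereal (real n)) \<in> shift_dom m l \<longleftrightarrow> 0 \<le> int n + l"
  "(\<infinity>, \<infinity>) \<in> shift_dom m l"
  by (auto simp: shift_dom_def unit_space_def shift_def nat_plus_int_mem_Zge_bar nat_plus_int_mem_Zge_bar')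

lemma compact_range_Un_limit:
  fixes f :: "nat \<Rightarrow> 'a::topological_space"
  assumes "f \<longlonglongrightarrow> l"
  shows "compact (range f \<union> {l})"
proof (rule compactI)
  fix C :: "'a set set"
  assume C: "\<forall>t\<in>C. open t" "range f \<union> {l} \<subseteq> \<Union>C"
  then obtain U where U: "U \<in> C" "l \<in> U" by auto
  then have "eventually (\<lambda>n. f n \<in> U) sequentially"
    using C(1) by (intro topological_tendstoD[OF assms]) auto
  then obtain N where N: "\<And>n. n \<ge> N \<Longrightarrow> f n \<in> U" by (auto simp: eventually_sequentially)
  have "\<forall>n. \<exists>V. V \<in> C \<and> f n \<in> V" using C(2) by auto
  then obtain V where V: "\<And>n. V n \<in> C" "\<And>n. f n \<in> V n" by metis
  have "f n \<in> \<Union>(insert U (V ` {..<N}))" for n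
    using N[of n] V(2)[of n] by (cases "n < N") auto
  then have "range f \<union> {l} \<subseteq> \<Union>(insert U (V ` {..<N}))" using U(2) by auto
  then show "\<exists>C'\<subseteq>C. finite C' \<and> range f \<union> {l} \<subseteq> \<Union>C'"
    using U(1) V(1) by (intro exI[of _ "insert U (V ` {..<N})"]) auto
qed

lemma compact_unit_space: "compact unit_space"
proof -
  have "(\<lambda>n::nat. ereal (real n)) \<longlonglongrightarrow> \<infinity>"
    by (simp add: tendsto_PInfty_eq_at_top filterlim_real_sequentially)
  then have "compact Zge_bar"
    unfolding Zge_bar_def by (rule compact_range_Un_limit)
  then show ?thesis
    unfolding unit_space_def by (intro compact_Un compact_Times) auto
qed

lemma continuous_on_shift [continuous_intros]: "continuous_on S (shift m l)"
proof -
  have "continuous_on UNIV (\<lambda>p. p + ereal r)" for r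
    unfolding continuous_on_def by (auto intro!: tendsto_add_ereal_general)
  then have "continuous_on S (\<lambda>x. fst x + ereal r)" "continuous_on S (\<lambda>x. snd x + ereal r)"
    for r and S :: "(ereal \<times> ereal) set"
    by (rule continuous_on_compose2[of UNIV]; auto intro: continuous_on_fst continuous_on_snd continuous_on_id)+
  then show ?thesis
    unfolding shift_def[abs_def] by (intro continuous_on_Pair) auto
qed

lemma compact_shift_dom: "compact (shift_dom m l)"
proof -
  have "closed unit_space" using compact_unit_space by (rule compact_imp_closed)
  then have "closed (shift m l -` unit_space)"
    using continuous_on_shift[of UNIV m l] by (rule closed_vimage)
  then have "compact (unit_space \<inter> shift m l -` unit_space)"
    by (rule compact_Int_closed[OF compact_unit_space])
  moreover have "shift_dom m l = unit_space \<inter> shift m l -` unit_space" by (auto simp: shift_dom_def)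
  ultimately show ?thesis by simp
qed

text \<open>A translation leaves the unit space only from points with a finite coordinate too small to
  absorb it. As finite sets are closed, \<open>shift_dom m l\<close> is clopen in the unit space; this is what
  makes characteristic functions of such domains, and products of weights, continuous.\<close>

lemma finite_unit_space_diff_shift_dom: "finite (unit_space - shift_dom m l)"
proof (rule finite_subset)
  show "unit_space - shift_dom m l \<subseteq>
     (\<lambda>n. (ereal (real n), \<infinity>)) ` {n. int n < - m} \<union> (\<lambda>n. (\<infinity>, ereal (real n))) ` {n. int n < - l}"
  proof
    fix x assume x: "x \<in> unit_space - shift_dom m l"
    then have "x \<in> unit_space" by simp
    then show "x \<in> (\<lambda>n. (ereal (real n), \<infinity>)) ` {n. int n < - m} \<union> (\<lambda>n. (\<infinity>, ereal (real n))) ` {n. int n < - l}"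
      by (cases rule: unit_space_cases) (use x in \<open>auto simp: image_iff\<close>)
  qed
  have "{n. int n < j} \<subseteq> {..<nat j}" for j by auto
  then have "finite {n. int n < j}" for j by (rule finite_subset) simp
  then show "finite ((\<lambda>n. (ereal (real n), \<infinity>::ereal)) ` {n. int n < - m} \<union> (\<lambda>n. (\<infinity>::ereal, ereal (real n))) ` {n. int n < - l})"
    by blast
qed

lemma continuous_on_if_clopen:
  assumes "closed A" "closed (S - A)" "continuous_on (S \<inter> A) f" "continuous_on (S - A) g"
  shows "continuous_on S (\<lambda>x. if x \<in> A then f x else g x)"
proof -
  let ?h = "\<lambda>x. if x \<in> A then f x else g x"
  have "continuous_on (S \<inter> A) ?h" "continuous_on (S - A) ?h"
    using assms(3,4) by (auto elim!: continuous_on_eq)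
  moreover have "closedin (top_of_set S) (S \<inter> A)" "closedin (top_of_set S) (S - A)"
    using assms(1,2) by (auto simp: closedin_closed)
  ultimately have "continuous_on ((S \<inter> A) \<union> (S - A)) ?h"
    by (intro continuous_on_Un_local) (auto simp: Int_Diff_Un)
  then show ?thesis by (simp add: Int_Diff_Un)
qed

lemma continuous_on_if_shift_dom:
  assumes S: "S \<subseteq> unit_space"
    and "continuous_on (S \<inter> shift_dom m l) f" "continuous_on (S - shift_dom m l) g"
  shows "continuous_on S (\<lambda>x. if x \<in> shift_dom m l then f x else g x)"
proof (rule continuous_on_if_clopen)
  show "closed (shift_dom m l)" using compact_shift_dom by (rule compact_imp_closed)
  have "finite (S - shift_dom m l)"
    using S by (intro finite_subset[OF _ finite_unit_space_diff_shift_dom[of m l]]) auto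
  then show "closed (S - shift_dom m l)" by (rule finite_imp_closed)
qed (use assms in auto)

section \<open>Compactly supported functions on the groupoid\<close>

definition graded :: "int \<Rightarrow> int \<Rightarrow> (ereal \<times> ereal \<Rightarrow> complex) \<Rightarrow> arrow \<Rightarrow> complex" where
  "graded m l \<phi> = (\<lambda>(m', l', x). if m' = m \<and> l' = l \<and> x \<in> shift_dom m l then \<phi> x else 0)"

text \<open>Continuity on the groupoid may be checked on each slice \<open>(m, l)\<close>, since the first two
  coordinates are discrete, and compactness of the support amounts to finitely many slices, since
  every slice is a compact subset of the unit space.\<close>

lemma CcI:
  assumes D: "finite D" and supp: "\<And>m l x. f (m, l, x) \<noteq> 0 \<Longrightarrow> (m, l) \<in> D \<and> (m, l, x) \<in> S"
    and S: "\<And>m l x. (m, l) \<in> D \<Longrightarrow> x \<in> shift_dom m l \<Longrightarrow> (m, l, x) \<in> S" "S \<subseteq> gpd"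
    and cont: "\<And>m l. continuous_on (shift_dom m l) (\<lambda>x. f (m, l, x))"
  shows "f \<in> Cc S"
proof -
  let ?K = "\<Union>(m, l)\<in>D. {m} \<times> {l} \<times> shift_dom m l"
  have "compact ?K"
    using D by (intro compact_UN) (auto intro!: compact_Times compact_shift_dom)
  moreover have "?K \<subseteq> S" using S by auto
  moreover have "f \<gamma> = 0" if "\<gamma> \<notin> ?K" for \<gamma>
  proof (rule ccontr)
    assume n: "f \<gamma> \<noteq> 0"
    obtain m l x where \<gamma>: "\<gamma> = (m, l, x)" by (metis surj_pair)
    have "(m, l) \<in> D" "(m, l, x) \<in> S" using supp[of m l x] n \<gamma> by auto
    then have "\<gamma> \<in> ?K" using S(2) by (force simp: \<gamma> mem_gpd[symmetric])
    then show False using that by simp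
  qed
  moreover have "continuous_on S f"
  proof (rule continuous_on_subset[OF _ S(2)])
    have slice: "continuous_on (gpd \<inter> {m} \<times> {l} \<times> UNIV) f" for m l
    proof -
      have "continuous_on (gpd \<inter> {m} \<times> {l} \<times> UNIV) (\<lambda>\<gamma>. f (m, l, snd (snd \<gamma>)))"
        by (rule continuous_on_compose2[OF cont[of m l]])
          (auto simp: mem_gpd intro!: continuous_intros)
      then show ?thesis
        by (rule continuous_on_eq) auto
    qed
    show "continuous_on gpd f"
      unfolding continuous_on_def
    proof
      fix \<gamma> assume "\<gamma> \<in> gpd"
      obtain m l x where \<gamma>: "\<gamma> = (m, l, x)" by (metis surj_pair)
      have "at \<gamma> within gpd = at \<gamma> within (gpd \<inter> {m} \<times> {l} \<times> UNIV)"
        by (rule at_within_nhd[where S = "{m} \<times> {l} \<times> UNIV"])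
          (auto simp: \<gamma> intro!: open_Times open_discrete)
      then show "(f \<longlongrightarrow> f \<gamma>) (at \<gamma> within gpd)"
        using slice[of m l] \<open>\<gamma> \<in> gpd\<close> \<gamma> by (auto simp: continuous_on_def)
    qed
  qed
  ultimately show ?thesis unfolding Cc_def by blast
qed

definition degrees_within :: "(arrow \<Rightarrow> complex) \<Rightarrow> (int \<times> int) set \<Rightarrow> bool" where
  "degrees_within f D \<longleftrightarrow> (\<forall>m l x. f (m, l, x) \<noteq> 0 \<longrightarrow> (m, l) \<in> D)"

lemma degrees_withinD: "degrees_within f D \<Longrightarrow> f (m, l, x) \<noteq> 0 \<Longrightarrow> (m, l) \<in> D"
  unfolding degrees_within_def by blast

lemma degrees_within_graded: "degrees_within (graded m l \<phi>) {(m, l)}"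
  by (auto simp: degrees_within_def graded_def)

lemma degrees_within_mono: "degrees_within f D \<Longrightarrow> D \<subseteq> E \<Longrightarrow> degrees_within f E"
  unfolding degrees_within_def by blast

lemma degrees_within_add:
  "degrees_within f D \<Longrightarrow> degrees_within g D \<Longrightarrow> degrees_within (\<lambda>\<gamma>. f \<gamma> + g \<gamma>) D"
  unfolding degrees_within_def by (metis add_0)

lemma CcD:
  assumes "f \<in> Cc S"
  shows "\<gamma> \<notin> S \<Longrightarrow> f \<gamma> = 0" "continuous_on S f"
    "\<exists>D. finite D \<and> degrees_within f D"
proof -
  show "\<gamma> \<notin> S \<Longrightarrow> f \<gamma> = 0" "continuous_on S f"
    using assms by (auto simp: Cc_def simp del: split_paired_All)
  obtain D where "finite D" "\<And>m l p q. f (m, l, p, q) \<noteq> 0 \<Longrightarrow> (m, l) \<in> D"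
    using Cc_bounded_finite[OF assms] by metis
  then show "\<exists>D. finite D \<and> degrees_within f D"
    unfolding degrees_within_def by (metis surj_pair)
qed

lemma continuous_on_slice:
  assumes "f \<in> Cc gpd"
  shows "continuous_on (shift_dom m l) (\<lambda>x. f (m, l, x))"
  by (rule continuous_on_compose2[OF CcD(2)[OF assms]])
    (auto simp: mem_gpd intro!: continuous_intros)

lemma graded_in_Cc:
  assumes "continuous_on (shift_dom m l) \<phi>"
  shows "graded m l \<phi> \<in> Cc gpd" "graded m l \<phi> \<in> Cc (gpd_deg (m + l))"
proof -
  have c: "continuous_on (shift_dom m' l') (\<lambda>x. graded m l \<phi> (m', l', x))" for m' l'
  proof (cases "m' = m \<and> l' = l")
    case True
    then show ?thesis
      using assms by (auto simp: graded_def elim!: continuous_on_eq)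
  qed (auto simp: graded_def)
  show "graded m l \<phi> \<in> Cc gpd"
    by (rule CcI[where D = "{(m, l)}"]) (use c in \<open>auto simp: graded_def mem_gpd split: if_splits\<close>)
  show "graded m l \<phi> \<in> Cc (gpd_deg (m + l))"
    by (rule CcI[where D = "{(m, l)}"]) (use c in \<open>auto simp: graded_def mem_gpd gpd_deg_def split: if_splits\<close>)
qed

lemma Cc_gpd_deg_subset: "Cc (gpd_deg k) \<subseteq> Cc gpd"
proof
  fix f assume f: "f \<in> Cc (gpd_deg k)"
  obtain D where D: "finite D" "degrees_within f D"
    using CcD(3)[OF f] by blast
  show "f \<in> Cc gpd"
  proof (rule CcI[where D = D])
    show "continuous_on (shift_dom m l) (\<lambda>x. f (m, l, x))" for m l
    proof (cases "m + l = k")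
      case True
      show ?thesis
        by (rule continuous_on_compose2[OF CcD(2)[OF f]])
          (auto simp: mem_gpd gpd_deg_def True intro!: continuous_intros)
    next
      case False
      then have "f (m, l, x) = 0" for x
        by (intro CcD(1)[OF f]) (auto simp: gpd_deg_def)
      then show ?thesis by simp
    qed
  next
    fix m l x assume "f (m, l, x) \<noteq> 0"
    then show "(m, l) \<in> D \<and> (m, l, x) \<in> gpd"
      using degrees_withinD[OF D(2)] CcD(1)[OF f, of "(m, l, x)"] by (auto simp: gpd_deg_def)
  qed (use D in \<open>auto simp: mem_gpd\<close>)
qed

lemma Cc_add: "f \<in> Cc S \<Longrightarrow> g \<in> Cc S \<Longrightarrow> (\<lambda>\<gamma>. f \<gamma> + g \<gamma>) \<in> Cc S"
proof -
  assume "f \<in> Cc S" "g \<in> Cc S"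
  then obtain K K' where "compact K" "K \<subseteq> S" "\<forall>\<gamma>. \<gamma> \<notin> K \<longrightarrow> f \<gamma> = 0" "continuous_on S f"
    "compact K'" "K' \<subseteq> S" "\<forall>\<gamma>. \<gamma> \<notin> K' \<longrightarrow> g \<gamma> = 0" "continuous_on S g"
    by (auto simp: Cc_def)
  then show ?thesis
    unfolding Cc_def
    by (auto intro!: continuous_on_add exI[of _ "K \<union> K'"] compact_Un simp del: split_paired_All)
qed

lemma Cc_uminus: "f \<in> Cc S \<Longrightarrow> (\<lambda>\<gamma>. - f \<gamma>) \<in> Cc S"
  by (auto simp: Cc_def intro!: continuous_on_minus)

section \<open>Weighted translations in the regular representation\<close>

lemma ell2_op_eqI:
  fixes S T :: "'a ell2 \<Rightarrow>\<^sub>L 'b ell2"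
  assumes "\<And>\<xi> y. coord (blinfun_apply S \<xi>) y = coord (blinfun_apply T \<xi>) y"
  shows "S = T"
  using assms by (intro blinfun_eqI) (simp add: coord_inject[symmetric] fun_eq_iff)

lemma coord_sum: "coord (\<Sum>i\<in>I. \<xi> i) y = (\<Sum>i\<in>I. coord (\<xi> i) y)"
  by (induction I rule: infinite_finite_induct) (auto simp: plus_ell2.rep_eq zero_ell2.rep_eq)

lemma blinfun_apply_sum: "blinfun_apply (\<Sum>i\<in>I. T i) \<xi> = (\<Sum>i\<in>I. blinfun_apply (T i) \<xi>)"
  by (induction I rule: infinite_finite_induct) (auto simp: blinfun.add_left)

text \<open>Convolution only meets the arrows \<open>\<beta>\<close> with \<open>\<gamma> \<beta>\<inverse>\<close> in the support of \<open>f\<close>; for each degree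
  \<open>(m, l)\<close> there is at most one, so the series is a finite sum.\<close>

lemma coord_reg_rep_finite:
  assumes f: "f \<in> Cc gpd" and D: "finite D" "degrees_within f D"
  shows "coord (blinfun_apply (reg_rep f) \<xi>) (a, b, x) =
    (if (a, b, x) \<in> gpd then
      \<Sum>(m, l)\<in>D. if (a - m, b - l, x) \<in> gpd
        then f (m, l, shift (a - m) (b - l) x) * coord \<xi> (a - m, b - l, x) else 0 else 0)"
proof (cases "(a, b, x) \<in> gpd")
  case True
  let ?t = "\<lambda>\<beta>. (if (a, b, x) \<in> gpd \<and> \<beta> \<in> gpd \<and> src (a, b, x) = src \<beta>
      then f (gmul (a, b, x) (ginv \<beta>)) else 0) * coord \<xi> \<beta>"
  \<comment> \<open>The unique arrow \<open>\<beta>\<close> with \<open>\<gamma> \<beta>\<inverse>\<close> of degree \<open>(m, l)\<close>.\<close>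
  let ?g = "\<lambda>(m, l). (a - m, b - l, x)"
  have inj: "inj_on ?g D" by (auto simp: inj_on_def)
  have "coord (blinfun_apply (reg_rep f) \<xi>) (a, b, x) = infsum ?t UNIV"
    by (rule coord_reg_rep[OF f])
  also have "\<dots> = infsum ?t (?g ` D)"
  proof (rule infsum_cong_neutral)
    fix \<beta> assume \<beta>: "\<beta> \<in> UNIV - ?g ` D"
    obtain m l y where b: "\<beta> = (m, l, y)" by (metis surj_pair)
    show "?t \<beta> = 0"
    proof (rule ccontr)
      assume "?t \<beta> \<noteq> 0"
      then have "y = x" "f (a - m, b - l, shift m l y) \<noteq> 0" by (auto simp: b split: if_splits)
      then have "(a - m, b - l) \<in> D" "\<beta> = ?g (a - m, b - l)" using degrees_withinD[OF D(2)] b by auto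
      then show False using \<beta> by blast
    qed
  qed auto
  also have "\<dots> = sum ?t (?g ` D)" using D(1) by simp
  also have "\<dots> = (\<Sum>(m, l)\<in>D. ?t (a - m, b - l, x))"
    by (subst sum.reindex[OF inj]) (simp add: case_prod_unfold)
  finally show ?thesis
    using True by (auto simp: intro!: sum.cong)
next
  case False
  then show ?thesis by (simp add: coord_reg_rep[OF f])
qed

text \<open>The partial translation by \<open>(m, l)\<close> with weight \<open>\<phi>\<close> at the source. With weight \<open>1\<close> and
  \<open>(m, l) = (1, 0)\<close> this is the generator \<open>w\<^sub>1\<close>, with \<open>(0, 1)\<close> it is \<open>w\<^sub>2\<close>.\<close>

definition wshift :: "int \<Rightarrow> int \<Rightarrow> (ereal \<times> ereal \<Rightarrow> complex) \<Rightarrow> gop" where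
  "wshift m l \<phi> = reg_rep (graded m l \<phi>)"

lemma coord_wshift:
  assumes "continuous_on (shift_dom m l) \<phi>"
  shows "coord (blinfun_apply (wshift m l \<phi>) \<xi>) (a, b, x) =
    (if (a, b, x) \<in> gpd \<and> (a - m, b - l, x) \<in> gpd
     then \<phi> (shift (a - m) (b - l) x) * coord \<xi> (a - m, b - l, x) else 0)"
proof -
  have "shift (a - m) (b - l) x \<in> shift_dom m l" if "(a, b, x) \<in> gpd" "(a - m, b - l, x) \<in> gpd"
    using that by (auto simp: mem_gpd shift_dom_def shift_shift)
  then show ?thesis
    unfolding wshift_def
    by (subst coord_reg_rep_finite[OF graded_in_Cc(1)[OF assms] _ degrees_within_graded])
      (auto simp: graded_def split: if_splits)
qed

lemma wshift_cong:
  assumes "\<And>x. x \<in> shift_dom m l \<Longrightarrow> \<phi> x = \<psi> x"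
  shows "wshift m l \<phi> = wshift m l \<psi>"
proof -
  have "graded m l \<phi> = graded m l \<psi>" using assms by (auto simp: graded_def fun_eq_iff)
  then show ?thesis by (simp add: wshift_def)
qed

lemma continuous_on_wshift_compose:
  fixes \<phi> \<psi> :: "ereal \<times> ereal \<Rightarrow> complex"
  assumes \<phi>: "continuous_on (shift_dom m l) \<phi>" and \<psi>: "continuous_on (shift_dom m' l') \<psi>"
  shows "continuous_on (shift_dom (m + m') (l + l'))
    (\<lambda>x. if x \<in> shift_dom m' l' then \<phi> (shift m' l' x) * \<psi> x else 0)"
proof (rule continuous_on_if_shift_dom)
  show "continuous_on (shift_dom (m + m') (l + l') \<inter> shift_dom m' l') (\<lambda>x. \<phi> (shift m' l' x) * \<psi> x)"
  proof (intro continuous_on_mult)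
    show "continuous_on (shift_dom (m + m') (l + l') \<inter> shift_dom m' l') (\<lambda>x. \<phi> (shift m' l' x))"
      by (rule continuous_on_compose2[OF \<phi> continuous_on_shift]) (auto simp: shift_dom_def shift_shift)
    show "continuous_on (shift_dom (m + m') (l + l') \<inter> shift_dom m' l') \<psi>"
      by (rule continuous_on_subset[OF \<psi>]) auto
  qed
qed (auto simp: shift_dom_def)

text \<open>The product translates by the sum of the two vectors. The condition in the weight remains:
  the sum may be defined at points where the first translation already leaves the unit space.
  For opposite vectors this is what produces the range projections.\<close>

lemma wshift_compose:
  assumes \<phi>: "continuous_on (shift_dom m l) \<phi>" and \<psi>: "continuous_on (shift_dom m' l') \<psi>"
  shows "wshift m l \<phi> o\<^sub>L wshift m' l' \<psi> = wshift (m + m') (l + l')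
    (\<lambda>x. if x \<in> shift_dom m' l' then \<phi> (shift m' l' x) * \<psi> x else 0)" (is "_ = wshift _ _ ?\<chi>")
proof (rule ell2_op_eqI)
  fix \<xi> and \<gamma> :: arrow
  obtain a b x where \<gamma>: "\<gamma> = (a, b, x)" by (metis surj_pair)
  define c d where "c = a - (m + m')" "d = b - (l + l')"
  then have ab: "a = m + m' + c" "b = l + l' + d" by auto
  have sh: "a - m = m' + c" "b - l = l' + d" "a - m - m' = c" "b - l - l' = d"
    "a - (m + m') = c" "b - (l + l') = d" by (simp_all add: ab)
  have "shift (m' + c) (l' + d) x = shift m' l' (shift c d x)" by (simp add: shift_shift)
  then show "coord (blinfun_apply (wshift m l \<phi> o\<^sub>L wshift m' l' \<psi>) \<xi>) \<gamma>
      = coord (blinfun_apply (wshift (m + m') (l + l') ?\<chi>) \<xi>) \<gamma>"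
    unfolding \<gamma> blinfun_apply_blinfun_compose coord_wshift[OF \<phi>] coord_wshift[OF \<psi>]
      coord_wshift[OF continuous_on_wshift_compose[OF assms]] sh mem_gpd
    by (simp add: shift_dom_def)
qed

lemma reg_rep_add:
  assumes f: "f \<in> Cc gpd" and g: "g \<in> Cc gpd"
  shows "reg_rep (\<lambda>\<gamma>. f \<gamma> + g \<gamma>) = reg_rep f + reg_rep g"
proof (rule ell2_op_eqI)
  fix \<xi> and \<gamma> :: arrow
  obtain a b x where \<gamma>: "\<gamma> = (a, b, x)" by (metis surj_pair)
  obtain D where D: "finite D" "degrees_within f D"
    using CcD(3)[OF f] by blast
  obtain E where E: "finite E" "degrees_within g E"
    using CcD(3)[OF g] by blast
  have D': "finite (D \<union> E)" "degrees_within f (D \<union> E)" "degrees_within g (D \<union> E)"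
    using D E by (auto elim: degrees_within_mono)
  show "coord (blinfun_apply (reg_rep (\<lambda>\<gamma>. f \<gamma> + g \<gamma>)) \<xi>) \<gamma> = coord (blinfun_apply (reg_rep f + reg_rep g) \<xi>) \<gamma>"
    unfolding \<gamma> blinfun.add_left plus_ell2.rep_eq
      coord_reg_rep_finite[OF f D'(1,2)] coord_reg_rep_finite[OF g D'(1,3)]
      coord_reg_rep_finite[OF Cc_add[OF f g] D'(1) degrees_within_add[OF D'(2,3)]]
    by (auto simp: sum.distrib[symmetric] case_prod_unfold distrib_right intro!: sum.cong)
qed

lemma reg_rep_uminus:
  assumes f: "f \<in> Cc gpd"
  shows "reg_rep (\<lambda>\<gamma>. - f \<gamma>) = - reg_rep f"
proof -
  have "reg_rep (\<lambda>\<gamma>. f \<gamma> + - f \<gamma>) = 0"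
  proof (rule ell2_op_eqI)
    fix \<xi> and \<gamma> :: arrow
    obtain a b x where \<gamma>: "\<gamma> = (a, b, x)" by (metis surj_pair)
    have "degrees_within (\<lambda>\<gamma>. f \<gamma> + - f \<gamma>) {}" by (simp add: degrees_within_def)
    from coord_reg_rep_finite[OF Cc_add[OF f Cc_uminus[OF f]] finite.emptyI this]
    show "coord (blinfun_apply (reg_rep (\<lambda>\<gamma>. f \<gamma> + - f \<gamma>)) \<xi>) \<gamma> = coord (blinfun_apply 0 \<xi>) \<gamma>"
      unfolding \<gamma> by (simp only: sum.empty if_cancel blinfun.zero_left zero_ell2.rep_eq)
  qed
  moreover have "reg_rep (\<lambda>\<gamma>. f \<gamma> + - f \<gamma>) = reg_rep f + reg_rep (\<lambda>\<gamma>. - f \<gamma>)"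
    by (rule reg_rep_add[OF f Cc_uminus[OF f]])
  ultimately show ?thesis by (metis add.commute eq_neg_iff_add_eq_0)
qed

lemma reg_rep_eq_sum_wshift:
  assumes f: "f \<in> Cc gpd" and D: "finite D" "degrees_within f D"
  shows "reg_rep f = (\<Sum>(m, l)\<in>D. wshift m l (\<lambda>x. f (m, l, x)))"
proof (rule ell2_op_eqI)
  fix \<xi> and \<gamma> :: arrow
  obtain a b x where \<gamma>: "\<gamma> = (a, b, x)" by (metis surj_pair)
  show "coord (blinfun_apply (reg_rep f) \<xi>) \<gamma> = coord (blinfun_apply (\<Sum>(m, l)\<in>D. wshift m l (\<lambda>x. f (m, l, x))) \<xi>) \<gamma>"
    unfolding \<gamma> coord_reg_rep_finite[OF assms]
    by (auto simp: blinfun_apply_sum coord_sum case_prod_unfold coord_wshift[OF continuous_on_slice[OF f]] intro!: sum.cong)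
qed

definition reg_range :: "gop set" where "reg_range = reg_rep ` Cc gpd"

lemma reg_range_add: "S \<in> reg_range \<Longrightarrow> T \<in> reg_range \<Longrightarrow> S + T \<in> reg_range"
  unfolding reg_range_def by (auto simp: reg_rep_add[symmetric] intro: Cc_add)

lemma reg_range_uminus: "S \<in> reg_range \<Longrightarrow> - S \<in> reg_range"
  unfolding reg_range_def by (auto simp: reg_rep_uminus[symmetric] intro: Cc_uminus)

lemma wshift_in_reg_range: "continuous_on (shift_dom m l) \<phi> \<Longrightarrow> wshift m l \<phi> \<in> reg_range"
  unfolding reg_range_def wshift_def using graded_in_Cc by blast

lemma zero_in_reg_range: "0 \<in> reg_range"
  using reg_range_add[OF _ reg_range_uminus] wshift_in_reg_range[of 0 0 "\<lambda>_. 0"] by fastforce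

text \<open>Splitting a function into its finitely many slices shows that weighted translations span the
  image of the regular representation.\<close>

lemma reg_range_induct [consumes 1, case_names wshift zero add]:
  assumes "T \<in> reg_range"
    and "\<And>m l \<phi>. continuous_on (shift_dom m l) \<phi> \<Longrightarrow> Q (wshift m l \<phi>)"
    and "Q 0" "\<And>S T. Q S \<Longrightarrow> Q T \<Longrightarrow> Q (S + T)"
  shows "Q T"
proof -
  obtain f where f: "f \<in> Cc gpd" "T = reg_rep f" using assms(1) by (auto simp: reg_range_def)
  obtain D where D: "finite D" "degrees_within f D"
    using CcD(3)[OF f(1)] by blast
  have "Q (\<Sum>(m, l)\<in>E. wshift m l (\<lambda>x. f (m, l, x)))" for E
    by (induction E rule: infinite_finite_induct)
      (auto intro!: assms(2-4) continuous_on_slice f(1))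
  then show ?thesis using reg_rep_eq_sum_wshift[OF f(1) D] f(2) by simp
qed

lemma reg_range_compose:
  assumes "S \<in> reg_range" "T \<in> reg_range"
  shows "S o\<^sub>L T \<in> reg_range"
  using assms(1)
proof (induction rule: reg_range_induct)
  case (wshift m l \<phi>)
  show ?case using assms(2)
  proof (induction rule: reg_range_induct)
    case (wshift m' l' \<psi>)
    then show ?case
      using \<open>continuous_on (shift_dom m l) \<phi>\<close>
      by (simp add: wshift_compose wshift_in_reg_range continuous_on_wshift_compose)
  qed (auto simp: zero_in_reg_range bounded_bilinear.add_right[OF bounded_bilinear_blinfun_compose] intro: reg_range_add)
qed (auto simp: zero_in_reg_range bounded_bilinear.add_left[OF bounded_bilinear_blinfun_compose] intro: reg_range_add)

section \<open>Diagonal operators and the gauge action\<close>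

definition diag_op :: "('a \<Rightarrow> complex) \<Rightarrow> ('a ell2 \<Rightarrow>\<^sub>L 'a ell2)" where
  "diag_op d = ell2_op (\<lambda>y x. if y = x then d y else 0)"

text \<open>Gauge unitaries and complex scalars are both diagonal; a bound on the diagonal suffices for
  the Schur test.\<close>

lemma coord_diag_op:
  assumes B: "\<And>x. cmod (d x) \<le> B"
  shows "coord (blinfun_apply (diag_op d) \<xi>) y = d y * coord \<xi> y"
proof -
  have B0: "0 \<le> B" using B[of undefined] norm_ge_zero order_trans by blast
  let ?k = "\<lambda>y x. if y = x then d y else 0"
  have "coord (blinfun_apply (diag_op d) \<xi>) y = (\<Sum>\<^sub>\<infinity>x. ?k y x * coord \<xi> x)"
    unfolding diag_op_def
  proof (rule coord_ell2_op[OF B0])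
    show "(\<Sum>x\<in>F. cmod (?k y x)) \<le> B" if "finite F" for y and F :: "'a set"
    proof -
      have "(\<Sum>x\<in>F. cmod (?k y x)) = (\<Sum>x\<in>F. if y = x then cmod (d y) else 0)"
        by (rule sum.cong) auto
      then show ?thesis using that B B0 by simp
    qed
    show "(\<Sum>y\<in>F. cmod (?k y x)) \<le> B" if "finite F" for x and F :: "'a set"
    proof -
      have "(\<Sum>y\<in>F. cmod (?k y x)) = (\<Sum>y\<in>F. if y = x then cmod (d x) else 0)"
        by (rule sum.cong) auto
      then show ?thesis using that B B0 by simp
    qed
  qed
  also have "\<dots> = (\<Sum>\<^sub>\<infinity>x\<in>{y}. ?k y x * coord \<xi> x)"
    by (rule infsum_cong_neutral) auto
  finally show ?thesis by simp
qed

text \<open>Complex scalars as operators, so that complex linearity of \<open>T\<close> becomes the closed condition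
  \<open>T o\<^sub>L scalar_op c = scalar_op c o\<^sub>L T\<close>.\<close>

definition scalar_op :: "complex \<Rightarrow> ('a ell2 \<Rightarrow>\<^sub>L 'a ell2)" where
  "scalar_op c = diag_op (\<lambda>_. c)"

lemma coord_scalar_op: "coord (blinfun_apply (scalar_op c) \<xi>) y = c * coord \<xi> y"
  unfolding scalar_op_def by (rule coord_diag_op[where B = "cmod c"]) simp

lemma scalar_op_apply: "blinfun_apply (scalar_op c) \<xi> = ell2_scale c \<xi>"
  by (simp add: coord_inject[symmetric] fun_eq_iff coord_scalar_op ell2_scale.rep_eq)

lemma scalar_op_1: "scalar_op 1 = id_blinfun"
  by (rule ell2_op_eqI) (simp add: coord_scalar_op)

lemma scalar_op_mult: "scalar_op c o\<^sub>L scalar_op d = scalar_op (c * d)"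
  by (rule ell2_op_eqI) (simp add: coord_scalar_op)

lemma cmod_powi_unit: "cmod \<zeta> = 1 \<Longrightarrow> cmod (\<zeta> powi k) = 1"
  by (simp add: norm_power_int)

lemma coord_gauge:
  assumes "cmod \<zeta> = 1"
  shows "coord (blinfun_apply (gauge \<zeta>) \<xi>) \<gamma> = \<zeta> powi deg \<gamma> * coord \<xi> \<gamma>"
proof -
  have "gauge \<zeta> = diag_op (\<lambda>\<gamma>. \<zeta> powi deg \<gamma>)" by (simp add: gauge_def diag_op_def)
  then show ?thesis using coord_diag_op[of "\<lambda>\<gamma>. \<zeta> powi deg \<gamma>" 1 \<xi> \<gamma>] cmod_powi_unit[OF assms] by simp
qed

lemma cnj_powi_unit:
  assumes "cmod \<zeta> = 1" shows "cnj \<zeta> powi k = \<zeta> powi (- k)"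
proof -
  have "inverse \<zeta> = cnj \<zeta>"
    using complex_div_cnj[of 1 \<zeta>] assms by (simp add: inverse_eq_divide)
  then show ?thesis by (metis power_int_inverse power_int_minus)
qed

lemma gauge_cnj_gauge:
  assumes "cmod \<zeta> = 1"
  shows "gauge (cnj \<zeta>) o\<^sub>L gauge \<zeta> = id_blinfun"
proof (rule ell2_op_eqI)
  fix \<xi> and \<gamma> :: arrow
  have "\<zeta> \<noteq> 0" using assms by auto
  then have "\<zeta> powi (- j) * \<zeta> powi j = 1" for j by (simp add: power_int_minus)
  then show "coord (blinfun_apply (gauge (cnj \<zeta>) o\<^sub>L gauge \<zeta>) \<xi>) \<gamma> = coord (blinfun_apply id_blinfun \<xi>) \<gamma>"
    using assms by (simp add: coord_gauge cnj_powi_unit mult.assoc[symmetric])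
qed

lemma blinfun_compose_assoc: "(a o\<^sub>L b) o\<^sub>L c = a o\<^sub>L (b o\<^sub>L c)"
  by (rule blinfun_eqI) simp

lemma id_blinfun_compose: "id_blinfun o\<^sub>L a = a" "a o\<^sub>L id_blinfun = a"
  by (rule blinfun_eqI; simp)+

lemma gauge_action_compose:
  assumes "cmod \<zeta> = 1"
  shows "gauge_action \<zeta> (a o\<^sub>L b) = gauge_action \<zeta> a o\<^sub>L gauge_action \<zeta> b"
proof -
  have "gauge_action \<zeta> a o\<^sub>L gauge_action \<zeta> b
      = gauge \<zeta> o\<^sub>L a o\<^sub>L (gauge (cnj \<zeta>) o\<^sub>L gauge \<zeta>) o\<^sub>L b o\<^sub>L gauge (cnj \<zeta>)"
    unfolding gauge_action_def by (simp only: blinfun_compose_assoc)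
  then show ?thesis
    by (simp add: gauge_cnj_gauge[OF assms] gauge_action_def blinfun_compose_assoc id_blinfun_compose)
qed

lemmas blinfun_compose_add_left = bounded_bilinear.add_left[OF bounded_bilinear_blinfun_compose]
lemmas blinfun_compose_add_right = bounded_bilinear.add_right[OF bounded_bilinear_blinfun_compose]
lemmas blinfun_compose_minus_left = bounded_bilinear.minus_left[OF bounded_bilinear_blinfun_compose]
lemmas blinfun_compose_minus_right = bounded_bilinear.minus_right[OF bounded_bilinear_blinfun_compose]
lemmas blinfun_compose_sum_left = bounded_bilinear.sum_left[OF bounded_bilinear_blinfun_compose]

lemma gauge_action_add: "gauge_action \<zeta> (a + b) = gauge_action \<zeta> a + gauge_action \<zeta> b"
  by (simp add: gauge_action_def blinfun_compose_add_left blinfun_compose_add_right)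

lemma gauge_action_uminus: "gauge_action \<zeta> (- a) = - gauge_action \<zeta> a"
  by (simp add: gauge_action_def blinfun_compose_minus_left blinfun_compose_minus_right)

section \<open>The C*-algebra and its spectral subspaces\<close>

lemma C_S3H_eq: "C_S3H = closure reg_range"
  by (simp add: C_S3H_def reg_range_def)

lemma wshift_in_C_S3H: "continuous_on (shift_dom m l) \<phi> \<Longrightarrow> wshift m l \<phi> \<in> C_S3H"
  unfolding C_S3H_eq using closure_subset wshift_in_reg_range by blast

lemma C_S3H_add:
  assumes "a \<in> C_S3H" "b \<in> C_S3H" shows "a + b \<in> C_S3H"
proof -
  obtain x y where "\<And>n. x n \<in> reg_range" "x \<longlonglongrightarrow> a" "\<And>n. y n \<in> reg_range" "y \<longlonglongrightarrow> b"
    using assms unfolding C_S3H_eq closure_sequential by metis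
  then show ?thesis
    unfolding C_S3H_eq closure_sequential
    by (intro exI[of _ "\<lambda>n. x n + y n"]) (auto intro: reg_range_add tendsto_add)
qed

lemma C_S3H_compose:
  assumes "a \<in> C_S3H" "b \<in> C_S3H" shows "a o\<^sub>L b \<in> C_S3H"
proof -
  obtain x y where "\<And>n. x n \<in> reg_range" "x \<longlonglongrightarrow> a" "\<And>n. y n \<in> reg_range" "y \<longlonglongrightarrow> b"
    using assms unfolding C_S3H_eq closure_sequential by metis
  then show ?thesis
    unfolding C_S3H_eq closure_sequential
    by (intro exI[of _ "\<lambda>n. x n o\<^sub>L y n"])
      (auto intro: reg_range_compose bounded_bilinear.tendsto[OF bounded_bilinear_blinfun_compose])
qed

lemma C_S3H_uminus:
  assumes "a \<in> C_S3H" shows "- a \<in> C_S3H"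
proof -
  obtain x where "\<And>n. x n \<in> reg_range" "x \<longlonglongrightarrow> a"
    using assms unfolding C_S3H_eq closure_sequential by metis
  then show ?thesis
    unfolding C_S3H_eq closure_sequential
    by (intro exI[of _ "\<lambda>n. - x n"]) (auto intro: reg_range_uminus tendsto_minus)
qed

text \<open>Sums of weighted translations are dense in the C*-algebra, so a closed condition that is
  preserved by sums need only be verified on weighted translations.\<close>

lemma C_S3H_closed_property:
  assumes "a \<in> C_S3H" "closed {T. Q T}"
    and "\<And>m l \<phi>. continuous_on (shift_dom m l) \<phi> \<Longrightarrow> Q (wshift m l \<phi>)"
    and "Q 0" "\<And>S T. Q S \<Longrightarrow> Q T \<Longrightarrow> Q (S + T)"
  shows "Q a"
proof -
  have "reg_range \<subseteq> {T. Q T}" using reg_range_induct[of _ Q] assms(3-5) by auto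
  then have "closure reg_range \<subseteq> {T. Q T}" using assms(2) by (rule closure_minimal)
  then show ?thesis using assms(1) by (auto simp: C_S3H_eq)
qed

text \<open>Bounded operators are only real linear by type. Complex linearity of the elements of the
  algebra is needed to move the phase \<open>\<zeta> powi k\<close> past a factor.\<close>

lemma C_S3H_scalar_op:
  assumes "a \<in> C_S3H" shows "a o\<^sub>L scalar_op c = scalar_op c o\<^sub>L a"
  using assms
proof (rule C_S3H_closed_property)
  show "closed {T :: gop. T o\<^sub>L scalar_op c = scalar_op c o\<^sub>L T}"
    by (intro closed_Collect_eq continuous_intros)
next
  fix m l and \<phi> :: "ereal \<times> ereal \<Rightarrow> complex" assume \<phi>: "continuous_on (shift_dom m l) \<phi>"
  show "wshift m l \<phi> o\<^sub>L scalar_op c = scalar_op c o\<^sub>L wshift m l \<phi>"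
  proof (rule ell2_op_eqI)
    fix \<xi> and \<gamma> :: arrow
    obtain a b x where \<gamma>: "\<gamma> = (a, b, x)" by (metis surj_pair)
    show "coord (blinfun_apply (wshift m l \<phi> o\<^sub>L scalar_op c) \<xi>) \<gamma> =
        coord (blinfun_apply (scalar_op c o\<^sub>L wshift m l \<phi>) \<xi>) \<gamma>"
      unfolding \<gamma> by (simp add: coord_wshift[OF \<phi>] coord_scalar_op)
  qed
qed (auto simp: blinfun_compose_add_left blinfun_compose_add_right)

lemma line_bundle_iff:
  "a \<in> line_bundle k \<longleftrightarrow> a \<in> C_S3H \<and> (\<forall>\<zeta>. cmod \<zeta> = 1 \<longrightarrow> gauge_action \<zeta> a = scalar_op (\<zeta> powi k) o\<^sub>L a)"
  unfolding line_bundle_def by (auto simp: scalar_op_apply intro!: blinfun_eqI)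

lemma C_P1T_eq_line_bundle: "C_P1T = line_bundle 0"
  unfolding C_P1T_def by (auto simp: line_bundle_iff scalar_op_1 id_blinfun_compose)

lemma line_bundle_add: "a \<in> line_bundle k \<Longrightarrow> b \<in> line_bundle k \<Longrightarrow> a + b \<in> line_bundle k"
  by (simp add: line_bundle_iff C_S3H_add gauge_action_add blinfun_compose_add_right)

lemma line_bundle_uminus: "a \<in> line_bundle k \<Longrightarrow> - a \<in> line_bundle k"
  by (simp add: line_bundle_iff C_S3H_uminus gauge_action_uminus blinfun_compose_minus_right)

lemma line_bundle_compose:
  assumes "a \<in> line_bundle j" "b \<in> line_bundle k"
  shows "a o\<^sub>L b \<in> line_bundle (j + k)"
  unfolding line_bundle_iff
proof (intro conjI allI impI)
  have ab: "a \<in> C_S3H" "b \<in> C_S3H" using assms by (auto simp: line_bundle_iff)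
  then show "a o\<^sub>L b \<in> C_S3H" by (rule C_S3H_compose)
  fix \<zeta> :: complex assume \<zeta>: "cmod \<zeta> = 1"
  then have "\<zeta> \<noteq> 0" by auto
  have "gauge_action \<zeta> (a o\<^sub>L b) = scalar_op (\<zeta> powi j) o\<^sub>L (a o\<^sub>L scalar_op (\<zeta> powi k)) o\<^sub>L b"
    using assms \<zeta> by (simp add: gauge_action_compose line_bundle_iff blinfun_compose_assoc)
  also have "\<dots> = (scalar_op (\<zeta> powi j) o\<^sub>L scalar_op (\<zeta> powi k)) o\<^sub>L (a o\<^sub>L b)"
    by (simp add: C_S3H_scalar_op[OF ab(1)] blinfun_compose_assoc)
  finally show "gauge_action \<zeta> (a o\<^sub>L b) = scalar_op (\<zeta> powi (j + k)) o\<^sub>L (a o\<^sub>L b)"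
    using \<open>\<zeta> \<noteq> 0\<close> by (simp add: scalar_op_mult power_int_add)
qed

text \<open>A translation by \<open>(m, l)\<close> raises the degree of arrows by \<open>m + l\<close>, so the two gauge unitaries
  around it leave the phase \<open>\<zeta> powi (m + l)\<close>.\<close>

lemma wshift_in_line_bundle:
  assumes \<phi>: "continuous_on (shift_dom m l) \<phi>" and k: "k = m + l"
  shows "wshift m l \<phi> \<in> line_bundle k"
  unfolding line_bundle_iff
proof (intro conjI allI impI wshift_in_C_S3H \<phi>)
  fix \<zeta> :: complex assume \<zeta>: "cmod \<zeta> = 1"
  then have z: "\<zeta> \<noteq> 0" by auto
  show "gauge_action \<zeta> (wshift m l \<phi>) = scalar_op (\<zeta> powi k) o\<^sub>L wshift m l \<phi>"
  proof (rule ell2_op_eqI)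
    fix \<xi> and \<gamma> :: arrow
    obtain a b x where \<gamma>: "\<gamma> = (a, b, x)" by (metis surj_pair)
    have "\<zeta> powi (a + b) * \<zeta> powi (- (a - m + (b - l))) = \<zeta> powi k"
      using z by (simp add: k power_int_add[symmetric])
    then show "coord (blinfun_apply (gauge_action \<zeta> (wshift m l \<phi>)) \<xi>) \<gamma> =
        coord (blinfun_apply (scalar_op (\<zeta> powi k) o\<^sub>L wshift m l \<phi>) \<xi>) \<gamma>"
      unfolding \<gamma> using \<zeta>
      by (simp add: gauge_action_def coord_wshift[OF \<phi>] coord_scalar_op coord_gauge cnj_powi_unit
          mult.left_commute[of "\<phi> _"] del: minus_add_distrib minus_diff_eq)
  qed
qed

lemma unit_compose:
  assumes "a \<in> C_S3H"
  shows "wshift 0 0 (\<lambda>_. 1) o\<^sub>L a = a" "a o\<^sub>L wshift 0 0 (\<lambda>_. 1) = a"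
proof -
  have c: "continuous_on (shift_dom 0 0) (\<lambda>_. 1 :: complex)" by simp
  show "wshift 0 0 (\<lambda>_. 1) o\<^sub>L a = a" using assms
  proof (rule C_S3H_closed_property)
    show "closed {T :: gop. wshift 0 0 (\<lambda>_. 1) o\<^sub>L T = T}"
      by (intro closed_Collect_eq continuous_intros)
  next
    fix m l and \<phi> :: "ereal \<times> ereal \<Rightarrow> complex" assume \<phi>: "continuous_on (shift_dom m l) \<phi>"
    show "wshift 0 0 (\<lambda>_. 1) o\<^sub>L wshift m l \<phi> = wshift m l \<phi>"
      unfolding wshift_compose[OF c \<phi>] by (auto intro!: wshift_cong)
  qed (auto simp: blinfun_compose_add_right)
  show "a o\<^sub>L wshift 0 0 (\<lambda>_. 1) = a" using assms
  proof (rule C_S3H_closed_property)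
    show "closed {T :: gop. T o\<^sub>L wshift 0 0 (\<lambda>_. 1) = T}"
      by (intro closed_Collect_eq continuous_intros)
  next
    fix m l and \<phi> :: "ereal \<times> ereal \<Rightarrow> complex" assume \<phi>: "continuous_on (shift_dom m l) \<phi>"
    show "wshift m l \<phi> o\<^sub>L wshift 0 0 (\<lambda>_. 1) = wshift m l \<phi>"
      unfolding wshift_compose[OF \<phi> c] by (auto simp: shift_dom_def intro!: wshift_cong)
  qed (auto simp: blinfun_compose_add_left)
qed

lemma I_tilde_eq: "I_tilde = wshift 0 0 (\<lambda>_. 1)"
proof -
  have e: "wshift 0 0 (\<lambda>_. 1) \<in> C_P1T"
    unfolding C_P1T_eq_line_bundle by (rule wshift_in_line_bundle) auto
  have u: "wshift 0 0 (\<lambda>_. 1) o\<^sub>L a = a \<and> a o\<^sub>L wshift 0 0 (\<lambda>_. 1) = a" if "a \<in> C_P1T" for a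
    using that unit_compose[of a] by (auto simp: C_P1T_def)
  show ?thesis
    unfolding I_tilde_def
  proof (rule the_equality)
    fix e' assume "e' \<in> C_P1T \<and> (\<forall>a\<in>C_P1T. e' o\<^sub>L a = a \<and> a o\<^sub>L e' = a)"
    then show "e' = wshift 0 0 (\<lambda>_. 1)" using e u by metis
  qed (use e u in blast)
qed

lemma I_tilde_in_C_P1T: "I_tilde \<in> C_P1T"
  unfolding C_P1T_eq_line_bundle I_tilde_eq by (rule wshift_in_line_bundle) auto

lemma I_tilde_compose:
  assumes "a \<in> line_bundle k"
  shows "I_tilde o\<^sub>L a = a" "a o\<^sub>L I_tilde = a"
  using assms unit_compose[of a] by (auto simp: line_bundle_iff I_tilde_eq)

lemma line_bundle_zero: "0 \<in> line_bundle k"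
proof -
  have "wshift k 0 (\<lambda>_. 1) \<in> line_bundle k" by (rule wshift_in_line_bundle) auto
  from line_bundle_add[OF this line_bundle_uminus[OF this]] show ?thesis by simp
qed

lemma line_bundle_sum: "(\<And>i. i \<in> I \<Longrightarrow> a i \<in> line_bundle k) \<Longrightarrow> (\<Sum>i\<in>I. a i) \<in> line_bundle k"
  by (induction I rule: infinite_finite_induct) (auto intro: line_bundle_add line_bundle_zero)

lemma left_module_line_bundle: "left_module C_P1T I_tilde (line_bundle k) blinfun_compose"
  unfolding left_module_def C_P1T_eq_line_bundle
  using line_bundle_compose[of _ 0 _ k]
  by (auto simp: line_bundle_zero line_bundle_add line_bundle_uminus I_tilde_compose blinfun_compose_assoc
      blinfun_compose_add_left blinfun_compose_add_right)

section \<open>Modules with a finite frame\<close>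

lemma row_mult_add: "row_mult n (v + w) P = row_mult n v P + row_mult n w P"
  by (auto simp: row_mult_def fun_eq_iff blinfun_compose_add_left sum.distrib)

lemma row_mult_uminus: "row_mult n (- v) P = - row_mult n v P"
  by (auto simp: row_mult_def fun_eq_iff blinfun_compose_minus_left sum_negf)

lemma row_mult_zero: "row_mult n 0 P = 0"
  by (auto simp: row_mult_def fun_eq_iff)

lemma blinfun_compose_sum_right: "a o\<^sub>L (\<Sum>i\<in>I. b i) = (\<Sum>i\<in>I. a o\<^sub>L b i)"
  by (rule bounded_bilinear.sum_right[OF bounded_bilinear_blinfun_compose])

lemma row_mult_row_act: "row_mult n (row_act a v) P = row_act a (row_mult n v P)"
  by (auto simp: row_mult_def row_act_def fun_eq_iff blinfun_compose_sum_right blinfun_compose_assoc)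

lemma row_mult_in_row_vectors:
  assumes "P \<in> matrices C_P1T n" "v \<in> row_vectors C_P1T n"
  shows "row_mult n v P \<in> row_vectors C_P1T n"
  using assms line_bundle_compose[of _ 0 _ 0] unfolding C_P1T_eq_line_bundle
  by (auto simp: row_mult_def row_vectors_def matrices_def intro!: line_bundle_sum)

lemma left_module_proj_module:
  assumes "P \<in> matrices C_P1T n"
  shows "left_module C_P1T I_tilde (proj_module C_P1T n P) row_act"
proof -
  let ?R = "row_vectors C_P1T n"
  have R: "0 \<in> ?R" "v + w \<in> ?R" "- v \<in> ?R" "row_act a v \<in> ?R"
    if "v \<in> ?R" "w \<in> ?R" "a \<in> C_P1T" for v w a
    using that line_bundle_compose[of a 0 _ 0] unfolding C_P1T_eq_line_bundle
    by (auto simp: row_vectors_def row_act_def line_bundle_zero line_bundle_add line_bundle_uminus)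
  have z: "0 \<in> ?R" by (auto simp: row_vectors_def C_P1T_eq_line_bundle line_bundle_zero)
  have e: "row_act I_tilde x = x" if x: "x \<in> proj_module C_P1T n P" for x
  proof -
    have "x \<in> ?R" using x row_mult_in_row_vectors[OF assms] by (auto simp: proj_module_def)
    then have "I_tilde o\<^sub>L x i = x i" for i
      by (cases "i < n") (auto simp: row_vectors_def C_P1T_eq_line_bundle I_tilde_compose)
    then show ?thesis by (simp add: row_act_def)
  qed
  show ?thesis
    unfolding left_module_def
  proof (intro conjI ballI e)
    show "0 \<in> proj_module C_P1T n P"
      unfolding proj_module_def using z row_mult_zero[of n P] by (metis imageI)
  next
    fix x y assume "x \<in> proj_module C_P1T n P" "y \<in> proj_module C_P1T n P"
    then show "x + y \<in> proj_module C_P1T n P"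
      unfolding proj_module_def using R(2) I_tilde_in_C_P1T by (auto simp: row_mult_add[symmetric])
  next
    fix x assume "x \<in> proj_module C_P1T n P"
    then show "- x \<in> proj_module C_P1T n P"
      unfolding proj_module_def using R(3) I_tilde_in_C_P1T by (auto simp: row_mult_uminus[symmetric])
  next
    fix a x assume "a \<in> C_P1T" "x \<in> proj_module C_P1T n P"
    then show "row_act a x \<in> proj_module C_P1T n P"
      unfolding proj_module_def using R(4) by (auto simp: row_mult_row_act[symmetric])
  qed (auto simp: row_act_def fun_eq_iff blinfun_compose_assoc blinfun_compose_add_left blinfun_compose_add_right)
qed

text \<open>The identity \<open>\<Sum>\<^sub>i w\<^sub>i v\<^sub>i = 1\<close> says that \<open>y \<mapsto> \<Sum>\<^sub>i y\<^sub>i v\<^sub>i\<close> is a left inverse of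
  \<open>x \<mapsto> (x w\<^sub>j)\<^sub>j\<close>, and composing the two in the other order is multiplication by \<open>P\<close>. The degrees
  of \<open>v\<close> and \<open>w\<close> make these maps go between \<open>line_bundle k\<close> and rows over the degree \<open>0\<close> part.\<close>

lemma frame_isomorphism:
  fixes v w :: "nat \<Rightarrow> gop"
  assumes v: "\<And>i. i < n \<Longrightarrow> v i \<in> line_bundle k" and w: "\<And>i. i < n \<Longrightarrow> w i \<in> line_bundle (- k)"
    and resolution: "(\<Sum>i<n. w i o\<^sub>L v i) = I_tilde"
    and P: "P \<in> matrices C_P1T n" "\<And>i j. i < n \<Longrightarrow> j < n \<Longrightarrow> P i j = v i o\<^sub>L w j"
  shows "left_module_isomorphic C_P1T I_tilde (line_bundle k) blinfun_compose (proj_module C_P1T n P) row_act"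
    and "\<And>i j. i < n \<Longrightarrow> j < n \<Longrightarrow> (\<Sum>l<n. P i l o\<^sub>L P l j) = P i j"
proof -
  have wv: "(\<Sum>i<n. (x o\<^sub>L w i) o\<^sub>L v i) = x" if "x \<in> line_bundle j" for x j
    using that by (simp add: blinfun_compose_assoc blinfun_compose_sum_right[symmetric] resolution I_tilde_compose)
  show "(\<Sum>l<n. P i l o\<^sub>L P l j) = P i j" if "i < n" "j < n" for i j
  proof -
    have "(\<Sum>l<n. P i l o\<^sub>L P l j) = (\<Sum>l<n. (v i o\<^sub>L w l) o\<^sub>L v l) o\<^sub>L w j"
      using that by (simp add: P(2) blinfun_compose_assoc blinfun_compose_sum_left)
    then show ?thesis using that by (simp add: wv[OF v] P(2))
  qed
  let ?R = "row_vectors C_P1T n" and ?M = "proj_module C_P1T n P"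
  define \<phi> :: "gop \<Rightarrow> nat \<Rightarrow> gop" where "\<phi> = (\<lambda>x j. if j < n then x o\<^sub>L w j else 0)"
  define \<psi> :: "(nat \<Rightarrow> gop) \<Rightarrow> gop" where "\<psi> = (\<lambda>y. \<Sum>i<n. y i o\<^sub>L v i)"
  have \<phi>R: "\<phi> x \<in> ?R" if "x \<in> line_bundle k" for x
    using line_bundle_compose[OF that w] by (auto simp: row_vectors_def \<phi>_def C_P1T_eq_line_bundle)
  have \<psi>L: "\<psi> y \<in> line_bundle k" if "y \<in> ?R" for y
    unfolding \<psi>_def using that line_bundle_compose[of _ 0, OF _ v]
    by (intro line_bundle_sum) (auto simp: row_vectors_def C_P1T_eq_line_bundle)
  have \<psi>\<phi>: "\<psi> (\<phi> x) = x" if "x \<in> line_bundle k" for x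
    using wv[OF that] by (simp add: \<psi>_def \<phi>_def)
  have \<phi>\<psi>: "\<phi> (\<psi> y) = row_mult n y P" for y
    by (auto simp: \<psi>_def \<phi>_def row_mult_def fun_eq_iff blinfun_compose_sum_left blinfun_compose_assoc P(2))
  have inj: "inj_on \<phi> (line_bundle k)" by (rule inj_on_inverseI[of _ \<psi>]) (rule \<psi>\<phi>)
  have "\<phi> ` line_bundle k = ?M"
  proof
    show "\<phi> ` line_bundle k \<subseteq> ?M"
    proof
      fix z assume "z \<in> \<phi> ` line_bundle k"
      then obtain x where x: "x \<in> line_bundle k" "z = \<phi> x" by auto
      then have "z = row_mult n (\<phi> x) P" using \<phi>\<psi>[of "\<phi> x"] \<psi>\<phi> by simp
      then show "z \<in> ?M" using \<phi>R[OF x(1)] by (auto simp: proj_module_def)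
    qed
    show "?M \<subseteq> \<phi> ` line_bundle k"
      using \<psi>L by (auto simp: proj_module_def \<phi>\<psi>[symmetric])
  qed
  then have "bij_betw \<phi> (line_bundle k) ?M" using inj by (simp add: bij_betw_def)
  moreover have "\<phi> (x + y) = \<phi> x + \<phi> y" "\<phi> (a o\<^sub>L x) = row_act a (\<phi> x)" for x y a
    by (auto simp: \<phi>_def fun_eq_iff row_act_def blinfun_compose_add_left blinfun_compose_assoc)
  ultimately show "left_module_isomorphic C_P1T I_tilde (line_bundle k) blinfun_compose ?M row_act"
    unfolding left_module_isomorphic_def
    using left_module_line_bundle left_module_proj_module[OF P(1)] by blast
qed

section \<open>Matrix coefficients and finitely supported vectors\<close>

lift_definition delta :: "'a \<Rightarrow> 'a ell2" is "\<lambda>y x. if x = y then 1 else 0"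
proof -
  fix y :: 'a
  have "(\<lambda>x. (cmod (if x = y then 1 else 0))\<^sup>2) summable_on {y}" by simp
  then show "(\<lambda>x. (cmod (if x = y then 1 else 0))\<^sup>2) summable_on UNIV"
    by (rule summable_on_cong_neutral[THEN iffD1, rotated -1]) auto
qed

lemma norm_ell2_sq: "(norm \<xi>)\<^sup>2 = (\<Sum>\<^sub>\<infinity>x. (cmod (coord \<xi> x))\<^sup>2)"
  unfolding norm_ell2_def inner_ell2_self by (simp add: infsum_nonneg)

lemma norm_delta: "norm (delta y) = 1"
proof -
  have "(norm (delta y))\<^sup>2 = (\<Sum>\<^sub>\<infinity>x\<in>{y}. (cmod (coord (delta y) x))\<^sup>2)"
    unfolding norm_ell2_sq by (rule infsum_cong_neutral) (auto simp: delta.rep_eq)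
  also have "\<dots> = 1" by (simp add: delta.rep_eq)
  finally show ?thesis using norm_ge_zero[of "delta y"] by (simp add: power2_eq_1_iff)
qed

lemma cmod_coord_le_norm: "cmod (coord \<xi> x) \<le> norm \<xi>"
proof -
  have "(cmod (coord \<xi> x))\<^sup>2 = (\<Sum>y\<in>{x}. (cmod (coord \<xi> y))\<^sup>2)" by simp
  also have "\<dots> \<le> (norm \<xi>)\<^sup>2"
    unfolding norm_ell2_sq by (rule finite_sum_le_infsum) (auto simp: coord_summable)
  finally show ?thesis by (rule power2_le_imp_le) simp
qed

lemma cmod_matrix_coefficient_le: "cmod (coord (blinfun_apply T (delta y)) x) \<le> norm T"
  using cmod_coord_le_norm[of "blinfun_apply T (delta y)" x] norm_blinfun[of T "delta y"]
  by (simp add: norm_delta)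

lemma finite_support_approximation:
  "((\<lambda>F. \<Sum>x\<in>F. ell2_scale (coord \<xi> x) (delta x)) \<longlongrightarrow> \<xi>) (finite_subsets_at_top UNIV)"
proof -
  let ?f = "\<lambda>x. (cmod (coord \<xi> x))\<^sup>2"
  let ?t = "\<lambda>F. \<Sum>x\<in>F. ell2_scale (coord \<xi> x) (delta x)"
  have c: "coord (?t F) y = (if y \<in> F then coord \<xi> y else 0)" if "finite F" for F y
    using that by (simp add: coord_sum ell2_scale.rep_eq delta.rep_eq if_distrib[of "times _"] cong: if_cong)
  have n: "norm (?t F - \<xi>) = sqrt (infsum ?f UNIV - sum ?f F)" if F: "finite F" for F
  proof -
    have "(norm (?t F - \<xi>))\<^sup>2 = infsum ?f (UNIV - F)"
      unfolding norm_ell2_sq by (rule infsum_cong_neutral) (auto simp: minus_ell2.rep_eq c F)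
    also have "\<dots> = infsum ?f UNIV - infsum ?f F"
      by (rule infsum_Diff) (auto simp: coord_summable F)
    finally have "(norm (?t F - \<xi>))\<^sup>2 = infsum ?f UNIV - sum ?f F" using F by simp
    then show ?thesis by (metis norm_ge_zero real_sqrt_unique)
  qed
  have "(sum ?f \<longlongrightarrow> infsum ?f UNIV) (finite_subsets_at_top UNIV)"
    using coord_summable by (rule infsum_tendsto)
  then have "((\<lambda>F. sqrt (infsum ?f UNIV - sum ?f F)) \<longlongrightarrow> sqrt (infsum ?f UNIV - infsum ?f UNIV))
      (finite_subsets_at_top UNIV)"
    by (intro tendsto_intros)
  moreover have "\<forall>\<^sub>F F in finite_subsets_at_top UNIV. sqrt (infsum ?f UNIV - sum ?f F) = norm (?t F - \<xi>)"
    by (rule eventually_finite_subsets_at_top_weakI) (simp add: n)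
  ultimately have "((\<lambda>F. norm (?t F - \<xi>)) \<longlongrightarrow> sqrt (infsum ?f UNIV - infsum ?f UNIV))
      (finite_subsets_at_top UNIV)"
    by (rule Lim_transform_eventually)
  then show ?thesis by (simp add: tendsto_norm_zero_iff LIM_zero_iff)
qed

text \<open>Complex linearity is essential: a bounded real linear operator may vanish on all basis
  vectors and still be nonzero, like the operator of taking imaginary parts.\<close>

lemma eq_zero_if_matrix_coefficients_zero:
  fixes T :: "'a ell2 \<Rightarrow>\<^sub>L 'a ell2"
  assumes lin: "\<And>c. T o\<^sub>L scalar_op c = scalar_op c o\<^sub>L T"
    and zero: "\<And>x y. coord (blinfun_apply T (delta y)) x = 0"
  shows "T = 0"
proof (rule blinfun_eqI)
  fix \<xi>
  have d: "blinfun_apply T (delta y) = 0" for y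
    by (simp add: coord_inject[symmetric] fun_eq_iff zero zero_ell2.rep_eq)
  have "blinfun_apply T (ell2_scale c (delta y)) = 0" for c y
  proof -
    have "blinfun_apply T (ell2_scale c (delta y)) = blinfun_apply (T o\<^sub>L scalar_op c) (delta y)"
      by (simp add: scalar_op_apply)
    also have "\<dots> = 0"
      unfolding lin by (simp add: d)
    finally show ?thesis .
  qed
  then have "blinfun_apply T (\<Sum>x\<in>F. ell2_scale (coord \<xi> x) (delta x)) = 0" for F
    by (simp add: blinfun.sum_right)
  moreover have "((\<lambda>F. blinfun_apply T (\<Sum>x\<in>F. ell2_scale (coord \<xi> x) (delta x))) \<longlongrightarrow> blinfun_apply T \<xi>)
      (finite_subsets_at_top UNIV)"
    by (intro tendsto_intros finite_support_approximation)
  ultimately show "blinfun_apply T \<xi> = blinfun_apply 0 \<xi>"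
    by (simp add: tendsto_const_iff)
qed

section \<open>Faithfulness of the representation on U\<close>

lemma coord_reg_rep_delta:
  assumes "f \<in> Cc gpd"
  shows "coord (blinfun_apply (reg_rep f) (delta \<beta>)) \<gamma> =
    (if \<gamma> \<in> gpd \<and> \<beta> \<in> gpd \<and> src \<gamma> = src \<beta> then f (gmul \<gamma> (ginv \<beta>)) else 0)"
proof -
  let ?k = "\<lambda>\<beta>. if \<gamma> \<in> gpd \<and> \<beta> \<in> gpd \<and> src \<gamma> = src \<beta> then f (gmul \<gamma> (ginv \<beta>)) else 0"
  have "coord (blinfun_apply (reg_rep f) (delta \<beta>)) \<gamma> = (\<Sum>\<^sub>\<infinity>\<beta>'\<in>{\<beta>}. ?k \<beta>' * coord (delta \<beta>) \<beta>')"
    unfolding coord_reg_rep[OF assms] by (rule infsum_cong_neutral) (auto simp: delta.rep_eq)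
  then show ?thesis by (simp add: delta.rep_eq)
qed

text \<open>At a point of \<open>U\<close> exactly one coordinate is finite, and it determines the translation.\<close>

lemma U_point_transport_unique:
  assumes "shift n l (U_point j) = U_point i" "U_point j = (p, q)" "l = - n"
  shows "{n. (p + ereal (of_int n), q - ereal (of_int n)) = U_point i} = {n}"
  using assms by (cases i; cases j) (auto simp: shift_def)

lemma coord_pi_rep_delta:
  assumes f: "f \<in> Cc gpd" and ij: "shift n (- n) (U_point j) = U_point i"
  shows "coord (blinfun_apply (pi_rep f) (delta j)) i = f (n, - n, U_point j)"
proof -
  let ?k = "\<lambda>j. case U_point j of (p, q) \<Rightarrow>
     (\<Sum>n | (p + ereal (of_int n), q - ereal (of_int n)) = U_point i. f (n, - n, p, q))"
  obtain p q where pq: "U_point j = (p, q)" by (metis surj_pair)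
  have "coord (blinfun_apply (pi_rep f) (delta j)) i = (\<Sum>\<^sub>\<infinity>j'\<in>{j}. ?k j' * coord (delta j) j')"
    unfolding coord_pi_rep[OF f] by (rule infsum_cong_neutral) (auto simp: delta.rep_eq)
  also have "\<dots> = ?k j" by (simp add: delta.rep_eq)
  also have "\<dots> = f (n, - n, U_point j)"
    using U_point_transport_unique[OF ij pq refl] by (simp add: pq)
  finally show ?thesis .
qed

text \<open>Values at arrows with source in \<open>U\<close> are matrix coefficients on \<open>\<ell>\<^sup>2(U)\<close>. The only other
  source is \<open>(\<infinity>, \<infinity>)\<close>, the limit of the points \<open>(b, \<infinity>)\<close>, where the bound follows by continuity.
  The estimate is stated for a difference because it is applied to two approximating sequences.\<close>

lemma Cc_deg_0_diff_le_norm_pi_rep: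
  assumes f: "f \<in> Cc (gpd_deg 0)" and g: "g \<in> Cc (gpd_deg 0)"
  shows "cmod (f \<gamma> - g \<gamma>) \<le> norm (pi_rep f - pi_rep g)"
proof (cases "\<gamma> \<in> gpd_deg 0")
  case True
  have fg: "f \<in> Cc gpd" "g \<in> Cc gpd" using f g Cc_gpd_deg_subset by auto
  obtain n l x where nlx: "\<gamma> = (n, l, x)" by (metis surj_pair)
  then have \<gamma>: "\<gamma> = (n, - n, x)" and x: "x \<in> shift_dom n (- n)"
    using True by (auto simp: gpd_deg_def mem_gpd add_eq_0_iff)
  have on_U: "cmod (f (n, - n, U_point j) - g (n, - n, U_point j)) \<le> norm (pi_rep f - pi_rep g)"
    if dom: "U_point j \<in> shift_dom n (- n)" for j
  proof -
    obtain i where i: "shift n (- n) (U_point j) = U_point i"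
    proof (cases j)
      case (Inl b)
      then have "real (nat (int b + n)) = real b + of_int n" using dom by simp
      then show ?thesis by (intro that[of "Inl (nat (int b + n))"]) (simp add: Inl shift_def)
    next
      case (Inr b)
      then have "real (nat (int b - n)) = real b - of_int n" using dom by simp
      then show ?thesis by (intro that[of "Inr (nat (int b - n))"]) (simp add: Inr shift_def)
    qed
    have "f (n, - n, U_point j) - g (n, - n, U_point j) = coord (blinfun_apply (pi_rep f - pi_rep g) (delta j)) i"
      by (simp add: coord_pi_rep_delta[OF _ i] fg blinfun.diff_left minus_ell2.rep_eq)
    then show ?thesis by (simp add: cmod_matrix_coefficient_le)
  qed
  have "x \<in> unit_space" using x by (simp add: shift_dom_def)
  then show ?thesis
  proof (cases rule: unit_space_cases)
    case (1 b)
    then show ?thesis using on_U[of "Inl b"] x \<gamma> by simp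
  next
    case (2 b)
    then show ?thesis using on_U[of "Inr b"] x \<gamma> by simp
  next
    case 3
    define y where "y = (\<lambda>b::nat. U_point (Inl b))"
    have ev: "eventually (\<lambda>b. y b \<in> shift_dom n (- n)) sequentially"
      unfolding eventually_sequentially by (rule exI[of _ "nat (- n)"]) (auto simp: y_def)
    have "(\<lambda>b::nat. ereal (real b)) \<longlonglongrightarrow> \<infinity>"
      by (simp add: tendsto_PInfty_eq_at_top filterlim_real_sequentially)
    then have "y \<longlonglongrightarrow> x"
      unfolding y_def 3 by (auto intro: tendsto_Pair)
    then have "(\<lambda>b. cmod (f (n, - n, y b) - g (n, - n, y b))) \<longlonglongrightarrow> cmod (f (n, - n, x) - g (n, - n, x))"
      by (intro tendsto_intros continuous_on_tendsto_compose[OF continuous_on_slice] fg ev x)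
    then show ?thesis
      unfolding \<gamma>
    proof (rule tendsto_upperbound)
      show "eventually (\<lambda>b. cmod (f (n, - n, y b) - g (n, - n, y b)) \<le> norm (pi_rep f - pi_rep g)) sequentially"
        using ev
      proof eventually_elim
        case (elim b)
        then show ?case using on_U[of "Inl b"] by (simp only: y_def)
      qed
    qed simp
  qed
next
  case False
  then show ?thesis using CcD(1)[OF f] CcD(1)[OF g] by simp
qed

text \<open>If two elements have the same image on \<open>\<ell>\<^sup>2(U)\<close>, the difference of approximating functions
  tends to \<open>0\<close> uniformly, hence so do its matrix coefficients in the regular representation, and
  an element of the algebra is determined by its matrix coefficients.\<close>

lemma pi_ext_faithful:
  assumes a: "a \<in> C_P1T" "pi_ext a T" and b: "b \<in> C_P1T" "pi_ext b T"
  shows "a = b"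
proof -
  obtain f where f: "\<And>n. f n \<in> Cc (gpd_deg 0)" "(\<lambda>n. reg_rep (f n)) \<longlonglongrightarrow> a" "(\<lambda>n. pi_rep (f n)) \<longlonglongrightarrow> T"
    using a by (auto simp: pi_ext_def)
  obtain g where g: "\<And>n. g n \<in> Cc (gpd_deg 0)" "(\<lambda>n. reg_rep (g n)) \<longlonglongrightarrow> b" "(\<lambda>n. pi_rep (g n)) \<longlonglongrightarrow> T"
    using b by (auto simp: pi_ext_def)
  have fg: "f n \<in> Cc gpd" "g n \<in> Cc gpd" for n using f(1) g(1) Cc_gpd_deg_subset by auto
  have "a - b = 0"
  proof (rule eq_zero_if_matrix_coefficients_zero)
    fix c
    have "a - b \<in> line_bundle 0"
      using a b line_bundle_add[OF _ line_bundle_uminus, of a 0 b] by (simp add: C_P1T_eq_line_bundle)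
    then show "(a - b) o\<^sub>L scalar_op c = scalar_op c o\<^sub>L (a - b)"
      by (intro C_S3H_scalar_op) (simp add: line_bundle_iff)
  next
    fix \<beta> \<gamma>
    let ?h = "\<lambda>S :: gop. coord (blinfun_apply S (delta \<beta>)) \<gamma>"
    let ?d = "\<lambda>n. norm (pi_rep (f n) - pi_rep (g n))"
    let ?e = "\<lambda>n. norm ((a - b) - (reg_rep (f n) - reg_rep (g n)))"
    have le: "cmod (?h (a - b)) \<le> ?d n + ?e n" for n
    proof -
      define R where "R = reg_rep (f n) - reg_rep (g n)"
      have "?h (a - b) = ?h R + ?h ((a - b) - R)"
        by (simp add: blinfun.diff_left minus_ell2.rep_eq)
      then have "cmod (?h (a - b)) \<le> cmod (?h R) + cmod (?h ((a - b) - R))"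
        by (simp only: norm_triangle_ineq)
      moreover have "?h R = (if \<gamma> \<in> gpd \<and> \<beta> \<in> gpd \<and> src \<gamma> = src \<beta>
          then f n (gmul \<gamma> (ginv \<beta>)) - g n (gmul \<gamma> (ginv \<beta>)) else 0)"
        by (simp add: R_def blinfun.diff_left minus_ell2.rep_eq coord_reg_rep_delta[OF fg(1)] coord_reg_rep_delta[OF fg(2)])
      then have "cmod (?h R) \<le> ?d n"
        using Cc_deg_0_diff_le_norm_pi_rep[OF f(1)[of n] g(1)[of n], of "gmul \<gamma> (ginv \<beta>)"] by simp
      moreover have "cmod (?h ((a - b) - R)) \<le> ?e n"
        unfolding R_def by (rule cmod_matrix_coefficient_le)
      ultimately show ?thesis by linarith
    qed
    have "(\<lambda>n. ?d n + ?e n) \<longlonglongrightarrow> norm (T - T) + norm ((a - b) - (a - b))"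
      by (intro tendsto_intros f g)
    then have "(\<lambda>n. ?d n + ?e n) \<longlonglongrightarrow> 0" by simp
    then have "cmod (?h (a - b)) \<le> 0"
      by (rule LIMSEQ_le_const) (use le in blast)
    then show "?h (a - b) = 0" by simp
  qed
  then show ?thesis by simp
qed

lemma coord_pi_rep_graded_0:
  assumes \<phi>: "continuous_on unit_space \<phi>"
  shows "coord (blinfun_apply (pi_rep (graded 0 0 \<phi>)) \<xi>) i = \<phi> (U_point i) * coord \<xi> i"
proof -
  let ?f = "graded 0 0 \<phi>"
  let ?k = "\<lambda>j. case U_point j of (p, q) \<Rightarrow>
     (\<Sum>n | (p + ereal (of_int n), q - ereal (of_int n)) = U_point i. ?f (n, - n, p, q))"
  have f: "?f \<in> Cc gpd" using graded_in_Cc(1)[of 0 0 \<phi>] \<phi> by simp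
  obtain p q where pq: "U_point i = (p, q)" by (metis surj_pair)
  have U: "U_point i \<in> unit_space" by (cases i) (auto simp: unit_space_def)
  have z: "?k j = 0" if "j \<noteq> i" for j
  proof -
    obtain p q where pq: "U_point j = (p, q)" by (metis surj_pair)
    have "U_point j \<noteq> U_point i" using that by (cases i; cases j) auto
    then show ?thesis
      by (auto simp: pq graded_def simp flip: zero_ereal_def intro!: sum.neutral)
  qed
  have "coord (blinfun_apply (pi_rep ?f) \<xi>) i = (\<Sum>\<^sub>\<infinity>j\<in>{i}. ?k j * coord \<xi> j)"
    unfolding coord_pi_rep[OF f] by (rule infsum_cong_neutral) (auto simp: z)
  also have "\<dots> = ?k i * coord \<xi> i" by simp
  also have "?k i = \<phi> (U_point i)"
    using U_point_transport_unique[of 0 0 i i p q] U by (simp add: pq graded_def)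
  finally show ?thesis by simp
qed

lemma coord_incl_left: "coord (blinfun_apply incl_left \<xi>) i = (case i of Inl a \<Rightarrow> coord \<xi> a | Inr _ \<Rightarrow> 0)"
proof -
  let ?k = "\<lambda>i j. if i = Inl j then 1 else 0 :: complex"
  have "coord (blinfun_apply incl_left \<xi>) i = (\<Sum>\<^sub>\<infinity>j. ?k i j * coord \<xi> j)"
    unfolding incl_left_def
  proof (rule coord_ell2_op[where C = 1])
    show "(\<Sum>j\<in>F. cmod (?k i j)) \<le> 1" if "finite F" for i :: "nat + nat" and F
    proof -
      have "(\<Sum>j\<in>F. cmod (?k i j)) \<le> real (card {projl i}) * 1"
        by (rule sum_le_card_times[where g = id]) (use that in auto)
      then show ?thesis by simp
    qed
    show "(\<Sum>i\<in>F. cmod (?k i j)) \<le> 1" if "finite F" for j and F :: "(nat + nat) set"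
    proof -
      have "(\<Sum>i\<in>F. cmod (?k i j)) \<le> real (card {Inl j :: nat + nat}) * 1"
        by (rule sum_le_card_times[where g = id]) (use that in auto)
      then show ?thesis by simp
    qed
  qed simp
  also have "\<dots> = (\<Sum>\<^sub>\<infinity>j\<in>(case i of Inl a \<Rightarrow> {a} | Inr _ \<Rightarrow> {}). ?k i j * coord \<xi> j)"
    by (rule infsum_cong_neutral) (auto split: sum.splits)
  also have "\<dots> = (case i of Inl a \<Rightarrow> coord \<xi> a | Inr _ \<Rightarrow> 0)"
    by (cases i) auto
  finally show ?thesis .
qed

lemma coord_proj_left: "coord (blinfun_apply proj_left \<xi>) i = coord \<xi> (Inl i)"
proof -
  let ?k = "\<lambda>i j. if j = Inl i then 1 else 0 :: complex"
  have "coord (blinfun_apply proj_left \<xi>) i = (\<Sum>\<^sub>\<infinity>j. ?k i j * coord \<xi> j)"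
    unfolding proj_left_def
  proof (rule coord_ell2_op[where C = 1])
    show "(\<Sum>j\<in>F. cmod (?k i j)) \<le> 1" if "finite F" for i and F :: "(nat + nat) set"
    proof -
      have "(\<Sum>j\<in>F. cmod (?k i j)) \<le> real (card {Inl i :: nat + nat}) * 1"
        by (rule sum_le_card_times[where g = id]) (use that in auto)
      then show ?thesis by simp
    qed
    show "(\<Sum>i\<in>F. cmod (?k i j)) \<le> 1" if "finite F" for j :: "nat + nat" and F
    proof -
      have "(\<Sum>i\<in>F. cmod (?k i j)) \<le> real (card {projl j}) * 1"
        by (rule sum_le_card_times[where g = id]) (use that in auto)
      then show ?thesis by simp
    qed
  qed simp
  also have "\<dots> = (\<Sum>\<^sub>\<infinity>j\<in>{Inl i}. ?k i j * coord \<xi> j)"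
    by (rule infsum_cong_neutral) auto
  finally show ?thesis by simp
qed

lemma coord_fin_proj: "coord (blinfun_apply (fin_proj m) \<xi>) i = (if i < m then coord \<xi> i else 0)"
proof -
  have "fin_proj m = diag_op (\<lambda>i. if i < m then 1 else 0)"
    unfolding fin_proj_def diag_op_def by (rule arg_cong[of _ _ ell2_op]) (auto simp: fun_eq_iff)
  then show ?thesis using coord_diag_op[of "\<lambda>i. if i < m then 1 else 0" 1 \<xi> i] by simp
qed

section \<open>The finite rank projections in the left summand\<close>

text \<open>The characteristic function of the corner \<open>{(p, \<infinity>). p < n}\<close>, written as that of the
  complement of the domain of the translation \<open>(- n, 0)\<close>: in this form its continuity and the relation to the range
  of \<open>w\<^sub>1\<^sup>n\<close> are immediate.\<close>

definition corner_weight :: "nat \<Rightarrow> ereal \<times> ereal \<Rightarrow> complex" where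
  "corner_weight n x = (if x \<in> shift_dom (- int n) 0 then 0 else 1)"

lemma continuous_on_corner_weight: "continuous_on (shift_dom m l) (corner_weight n)"
  unfolding corner_weight_def[abs_def] by (rule continuous_on_if_shift_dom) (auto simp: shift_dom_def)

lemma corner_weight_nonzeroE:
  assumes "x \<in> unit_space" "corner_weight n x \<noteq> 0"
  obtains p where "x = (ereal (real p), \<infinity>)" "p < n"
  using assms(1) by (cases rule: unit_space_cases) (use assms(2) that in \<open>auto simp: corner_weight_def split: if_splits\<close>)

lemma corner_weight_simps [simp]:
  "corner_weight n (ereal (real p), \<infinity>) = (if p < n then 1 else 0)" "corner_weight n (\<infinity>, ereal (real p)) = 0" "corner_weight n (\<infinity>, \<infinity>) = 0"
  by (auto simp: corner_weight_def)

text \<open>The weighted identity with weight \<open>corner_weight n\<close> is itself the image of a function in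
  \<open>Cc (gpd_deg 0)\<close>, so a constant sequence witnesses that it extends \<open>P\<^sub>n \<oplus> 0\<close>; faithfulness makes
  it the only such element.\<close>

lemma P_oplus_0_eq: "P_oplus_0 n = wshift 0 0 (corner_weight n)"
proof -
  have c: "continuous_on unit_space (corner_weight n)" using continuous_on_corner_weight[of 0 0 n] by simp
  have pi: "pi_rep (graded 0 0 (corner_weight n)) = op_dsum (fin_proj n) 0"
  proof (rule ell2_op_eqI)
    fix \<xi> i
    show "coord (blinfun_apply (pi_rep (graded 0 0 (corner_weight n))) \<xi>) i = coord (blinfun_apply (op_dsum (fin_proj n) 0) \<xi>) i"
      unfolding coord_pi_rep_graded_0[OF c]
      by (cases i) (auto simp: op_dsum_def coord_incl_left coord_proj_left coord_fin_proj)
  qed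
  have ext: "pi_ext (wshift 0 0 (corner_weight n)) (op_dsum (fin_proj n) 0)"
    unfolding pi_ext_def wshift_def
    by (rule exI[of _ "\<lambda>_. graded 0 0 (corner_weight n)"]) (use graded_in_Cc(2)[of 0 0 "corner_weight n"] c pi in auto)
  have A: "wshift 0 0 (corner_weight n) \<in> C_P1T"
    unfolding C_P1T_eq_line_bundle by (rule wshift_in_line_bundle) (auto simp: continuous_on_corner_weight c)
  show ?thesis
    unfolding P_oplus_0_def KK_embed_def
    by (rule the_equality) (use A ext pi_ext_faithful in blast)+
qed

lemma I_tilde_minus_P: "I_tilde - P_oplus_0 n = wshift 0 0 (\<lambda>x. 1 - corner_weight n x)"
proof (rule ell2_op_eqI)
  fix \<xi> and \<gamma> :: arrow
  obtain a b x where \<gamma>: "\<gamma> = (a, b, x)" by (metis surj_pair)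
  have c: "continuous_on (shift_dom 0 0) (\<lambda>x. 1 :: complex)" "continuous_on (shift_dom 0 0) (\<lambda>x. 1 - corner_weight n x)"
    using continuous_on_corner_weight[of 0 0 n] by (auto intro!: continuous_intros)
  show "coord (blinfun_apply (I_tilde - P_oplus_0 n) \<xi>) \<gamma> = coord (blinfun_apply (wshift 0 0 (\<lambda>x. 1 - corner_weight n x)) \<xi>) \<gamma>"
    unfolding \<gamma> I_tilde_eq P_oplus_0_eq blinfun.diff_left minus_ell2.rep_eq
      coord_wshift[OF c(1)] coord_wshift[OF c(2)] coord_wshift[OF continuous_on_corner_weight]
    by (simp add: algebra_simps)
qed

lemma wshift_0_self_adjoint:
  assumes \<phi>: "continuous_on (shift_dom 0 0) \<phi>" and real: "\<And>x. cnj (\<phi> x) = \<phi> x"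
  shows "ell2_adjoint (wshift 0 0 \<phi>) (wshift 0 0 \<phi>)"
  unfolding ell2_adjoint_def ell2_cinner_def
proof (intro allI infsum_cong)
  fix \<xi> \<eta> and \<gamma> :: arrow
  obtain a b x where \<gamma>: "\<gamma> = (a, b, x)" by (metis surj_pair)
  show "coord (blinfun_apply (wshift 0 0 \<phi>) \<xi>) \<gamma> * cnj (coord \<eta> \<gamma>) =
      coord \<xi> \<gamma> * cnj (coord (blinfun_apply (wshift 0 0 \<phi>) \<eta>) \<gamma>)"
    unfolding \<gamma> coord_wshift[OF \<phi>] by (simp add: real)
qed

section \<open>Frames of the line bundles\<close>

lemma wshift_zero: "wshift m l (\<lambda>_. 0) = 0"
proof (rule ell2_op_eqI)
  fix \<xi> and \<gamma> :: arrow
  obtain a b x where \<gamma>: "\<gamma> = (a, b, x)" by (metis surj_pair)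
  show "coord (blinfun_apply (wshift m l (\<lambda>_. 0)) \<xi>) \<gamma> = coord (blinfun_apply 0 \<xi>) \<gamma>"
    unfolding \<gamma> by (simp add: coord_wshift zero_ell2.rep_eq)
qed

text \<open>Adding \<open>n\<close> to the first coordinate never leaves the unit space, so \<open>v\<close> is an isometry.
  Subtracting it does so exactly on the corner, so \<open>v v* = 1 - (P\<^sub>n \<oplus> 0)\<close>.\<close>

lemma isometry_frame:
  defines "v \<equiv> \<lambda>n. wshift (int n) 0 (\<lambda>_. 1)" and "w \<equiv> \<lambda>n. wshift (- int n) 0 (\<lambda>_. 1)"
  shows "w n o\<^sub>L v n = I_tilde" "v n o\<^sub>L w n = I_tilde - P_oplus_0 n"
proof -
  have c: "continuous_on A (\<lambda>_. 1 :: complex)" for A :: "(ereal \<times> ereal) set" by simp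
  have "x \<in> shift_dom (int n) 0" if "x \<in> unit_space" for x
    using that by (cases rule: unit_space_cases) auto
  then show "w n o\<^sub>L v n = I_tilde"
    unfolding v_def w_def wshift_compose[OF c c] I_tilde_eq by (auto intro!: wshift_cong)
  show "v n o\<^sub>L w n = I_tilde - P_oplus_0 n"
    unfolding v_def w_def wshift_compose[OF c c] I_tilde_minus_P by (auto simp: corner_weight_def intro!: wshift_cong)
qed

text \<open>On the corner the second coordinate is infinite, so \<open>u\<close> moves no point and only changes the
  degree; hence \<open>u* u\<close> and \<open>u u*\<close> are both the projection of the corner. The corner is disjoint from
  the range of the isometry \<open>v\<close>, so \<open>u v = 0\<close> and \<open>v* u* = 0\<close>.\<close>

lemma corner_frame:
  defines "u \<equiv> \<lambda>n. wshift 0 (- int n) (corner_weight n)" and "u' \<equiv> \<lambda>n. wshift 0 (int n) (corner_weight n)"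
    and "v \<equiv> \<lambda>n. wshift (int n) 0 (\<lambda>_. 1)" and "w \<equiv> \<lambda>n. wshift (- int n) 0 (\<lambda>_. 1)"
  shows "u' n o\<^sub>L u n = P_oplus_0 n" "u n o\<^sub>L u' n = P_oplus_0 n"
    "u n o\<^sub>L v n = 0" "w n o\<^sub>L u' n = 0"
proof -
  have c: "continuous_on A (\<lambda>_. 1 :: complex)" for A :: "(ereal \<times> ereal) set" by simp
  have u': "(if x \<in> shift_dom 0 l then corner_weight n (shift 0 l x) * corner_weight n x else 0) = corner_weight n x"
    if "x \<in> unit_space" for l x
    using that by (cases rule: unit_space_cases) (auto simp: shift_def simp flip: zero_ereal_def)
  show "u' n o\<^sub>L u n = P_oplus_0 n"
    unfolding u_def u'_def wshift_compose[OF continuous_on_corner_weight continuous_on_corner_weight] P_oplus_0_eq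
    by (auto simp: u' simp del: if_split intro!: wshift_cong)
  show "u n o\<^sub>L u' n = P_oplus_0 n"
    unfolding u_def u'_def wshift_compose[OF continuous_on_corner_weight continuous_on_corner_weight] P_oplus_0_eq
    by (auto simp: u' simp del: if_split intro!: wshift_cong)
  have "corner_weight n (shift (int n) 0 x) = 0" if "x \<in> unit_space" for x
  proof -
    have "x \<in> shift_dom (int n) 0"
      using that by (cases rule: unit_space_cases) auto
    then show ?thesis by (simp add: corner_weight_def shift_dom_def shift_shift)
  qed
  then show "u n o\<^sub>L v n = 0"
    unfolding u_def v_def wshift_compose[OF continuous_on_corner_weight c] wshift_zero[symmetric, of "0 + int n" "- int n + 0"]
    by (intro wshift_cong) (auto simp: shift_dom_def)
  have "corner_weight n x = 0" if "x \<in> shift_dom (- int n + 0) (0 + int n)" for x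
  proof (rule ccontr)
    assume nz: "corner_weight n x \<noteq> 0"
    have "x \<in> unit_space" using that by (simp add: shift_dom_def)
    then obtain p where "x = (ereal (real p), \<infinity>)" "p < n"
      using nz by (rule corner_weight_nonzeroE)
    then show False using that by simp
  qed
  then show "w n o\<^sub>L u' n = 0"
    unfolding w_def u'_def wshift_compose[OF c continuous_on_corner_weight] wshift_zero[symmetric, of "- int n + 0" "0 + int n"]
    by (intro wshift_cong) auto
qed

lemma ell2_adjoint_zero: "ell2_adjoint 0 0"
  by (simp add: ell2_adjoint_def ell2_cinner_def zero_ell2.rep_eq)

lemma self_adjoint:
  "ell2_adjoint I_tilde I_tilde" "ell2_adjoint (P_oplus_0 n) (P_oplus_0 n)"
  "ell2_adjoint (I_tilde - P_oplus_0 n) (I_tilde - P_oplus_0 n)"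
  unfolding I_tilde_minus_P unfolding I_tilde_eq P_oplus_0_eq
  by (rule wshift_0_self_adjoint;
      use continuous_on_corner_weight[of 0 0 n] in \<open>auto simp: corner_weight_def intro!: continuous_intros\<close>)+

lemma wshift_1_in_line_bundle: "k = m + l \<Longrightarrow> wshift m l (\<lambda>_. 1) \<in> line_bundle k"
  by (rule wshift_in_line_bundle) auto

lemma P_oplus_0_in_line_bundle: "P_oplus_0 n \<in> line_bundle 0"
  unfolding P_oplus_0_eq by (rule wshift_in_line_bundle[OF continuous_on_corner_weight]) simp

lemma line_bundle_nonneg_projective:
  fixes n :: nat
  defines "P \<equiv> mat1 (I_tilde - P_oplus_0 n)"
  shows "P \<in> projections C_P1T 1"
    "left_module_isomorphic C_P1T I_tilde (line_bundle (int n)) blinfun_compose (proj_module C_P1T 1 P) row_act"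
proof -
  define v w where "v = (\<lambda>i::nat. wshift (int n) 0 (\<lambda>_. 1))" and "w = (\<lambda>i::nat. wshift (- int n) 0 (\<lambda>_. 1))"
  have v: "v i \<in> line_bundle (int n)" and w: "w i \<in> line_bundle (- int n)" for i
    unfolding v_def w_def by (auto intro: wshift_1_in_line_bundle)
  have res: "(\<Sum>i<1. w i o\<^sub>L v i) = I_tilde" by (simp add: v_def w_def isometry_frame)
  have "I_tilde - P_oplus_0 n \<in> C_P1T"
    using line_bundle_compose[OF v w] by (simp add: v_def w_def isometry_frame C_P1T_eq_line_bundle)
  then have M: "P \<in> matrices C_P1T 1" by (auto simp: matrices_def P_def mat1_def)
  have P: "P i j = v i o\<^sub>L w j" if "i < 1" "j < 1" for i j
    using that by (simp add: P_def mat1_def v_def w_def isometry_frame)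
  note frame = frame_isomorphism[of 1, OF v w res M P]
  show "left_module_isomorphic C_P1T I_tilde (line_bundle (int n)) blinfun_compose (proj_module C_P1T 1 P) row_act"
    by (rule frame(1))
  show "P \<in> projections C_P1T 1"
    unfolding projections_def using M frame(2) by (auto simp: P_def mat1_def self_adjoint)
qed

text \<open>In terms of \<open>v\<close> and \<open>u\<close> above the frame is \<open>(v*, u)\<close>. The initial projections \<open>v v*\<close> and
  \<open>u* u\<close> are complementary, so they add up to \<open>1\<close> and the mixed products vanish; the final
  projections \<open>v* v = 1\<close> and \<open>u u* = P\<^sub>n \<oplus> 0\<close> are the diagonal blocks.\<close>

lemma line_bundle_neg_projective:
  fixes n :: nat
  defines "P \<equiv> block_diag 1 (mat1 I_tilde) (mat1 (P_oplus_0 n))"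
  shows "P \<in> projections C_P1T 2"
    "left_module_isomorphic C_P1T I_tilde (line_bundle (- int n)) blinfun_compose (proj_module C_P1T 2 P) row_act"
proof -
  define v w where
    "v = (\<lambda>i::nat. if i = 0 then wshift (- int n) 0 (\<lambda>_. 1) else wshift 0 (- int n) (corner_weight n))" and
    "w = (\<lambda>i::nat. if i = 0 then wshift (int n) 0 (\<lambda>_. 1) else wshift 0 (int n) (corner_weight n))"
  have v: "v i \<in> line_bundle (- int n)" and w: "w i \<in> line_bundle (- (- int n))" for i
    unfolding v_def w_def by (auto intro: wshift_1_in_line_bundle wshift_in_line_bundle[OF continuous_on_corner_weight])
  have res: "(\<Sum>i<2. w i o\<^sub>L v i) = I_tilde"
    by (simp add: numeral_2_eq_2 v_def w_def isometry_frame corner_frame)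
  have P_entries: "P i j = (if i = 0 \<and> j = 0 then I_tilde else if i = 1 \<and> j = 1 then P_oplus_0 n else 0)" for i j
    by (auto simp: P_def block_diag_def mat1_def)
  have M: "P \<in> matrices C_P1T 2"
    by (auto simp: matrices_def P_entries C_P1T_eq_line_bundle line_bundle_zero P_oplus_0_in_line_bundle
        I_tilde_in_C_P1T[unfolded C_P1T_eq_line_bundle])
  have P: "P i j = v i o\<^sub>L w j" if "i < 2" "j < 2" for i j
    using that unfolding P_entries less_2_cases_iff by (auto simp: v_def w_def isometry_frame corner_frame)
  note frame = frame_isomorphism[of 2, OF v w res M P]
  show "left_module_isomorphic C_P1T I_tilde (line_bundle (- int n)) blinfun_compose (proj_module C_P1T 2 P) row_act"
    by (rule frame(1))
  show "P \<in> projections C_P1T 2"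
    unfolding projections_def using M frame(2) by (auto simp: P_entries self_adjoint ell2_adjoint_zero)
qed

theorem theorem4:
  fixes k :: int
  shows "(0 \<le> k \<longrightarrow>
           (let P = mat1 (I_tilde - P_oplus_0 (nat k))
            in P \<in> projections C_P1T 1 \<and>
               left_module_isomorphic C_P1T I_tilde
                 (line_bundle k) blinfun_compose (proj_module C_P1T 1 P) row_act)) \<and>
         (k < 0 \<longrightarrow>
           (let P = block_diag 1 (mat1 I_tilde) (mat1 (P_oplus_0 (nat (- k))))
            in P \<in> projections C_P1T 2 \<and>
               left_module_isomorphic C_P1T I_tilde
                 (line_bundle k) blinfun_compose (proj_module C_P1T 2 P) row_act))"
proof (cases "0 \<le> k")
  case True
  then show ?thesis using line_bundle_nonneg_projective[of "nat k"] by (simp add: Let_def)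
next
  case False
  then show ?thesis using line_bundle_neg_projective[of "nat (- k)"] by (simp add: Let_def)
qed

end
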